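(* Let $(X,r)$ be a non-degenerate symmetric set with $|X|\ge2$ (not necessarily finite), $(G,r_G)$ its associated symmetric group and $(\mathcal{G},r_{\mathcal{G}})$ its permutation group. (1) $(G,r_G)$ has finite multipermutation level if and only if $(X,r)$ is a multipermutation solution; in that case, writing $m=\mathrm{mpl}(G,r_G)$, $$0\le \mathrm{mpl}(\mathcal{G},r_{\mathcal{G}})=m-1\le \mathrm{mpl}(X,r)\le \mathrm{mpl}(G,r_G)=m<\infty.$$ (2) If moreover $(X,r)$ satisfies condition ( * ), then $\mathrm{mpl}(X,r)=m<\infty$ if and only if $\mathrm{mpl}(G,r_G)=m<\infty$. In particular this holds for all square-free solutions $(X,r)$ of arbitrary cardinality.
   Context: A symmetric set is a pair $(X,r)$, $X$ nonempty, $r:X\times X\to X\times X$ a bijection $r(x,y)=({}^xy,x^y)$ that is non-degenerate (all $y\mapsto{}^xy$, $y\mapsto y^x$ bijective), involutive, and satisfies $r^{12}r^{23}r^{12}=r^{23}r^{12}r^{23}$ on $X^3$. It is square-free if $r(x,x)=(x,x)$ for all $x$. Condition ( * ): for every $x\in X$ there is $a\in X$ with ${}^ax=x$. $G=G(X,r)$ is the group generated by $X$ with relations $xy=zt$ whenever $r(x,y)=(z,t)$; $X$ embeds in $G$. A symmetric group is a pair $(G,\sigma)$, $G$ a group, $\sigma(u,v)=({}^uv,u^v)$ an involutive bijection with ${}^a1=1,{}^1u=u,1^u=1,a^1=a$, ${}^{ab}u={}^a({}^bu)$, $a^{uv}=(a^u)^v$, ${}^a(uv)=({}^au)({}^{a^u}v)$,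 $(ab)^u=(a^{{}^bu})(b^u)$, $uv=({}^uv)(u^v)$; $(G,r_G)$ is $G(X,r)$ with the unique such involutive braiding extending $r$. $\mathcal{L}:G\to\mathrm{Sym}(X)$ extends $x\mapsto(y\mapsto{}^xy)$; $\mathcal{G}=\mathcal{L}(G)$, with symmetric group structure $r_{\mathcal{G}}(\mathcal{L}_a,\mathcal{L}_b)=(\mathcal{L}_{{}^ab},\mathcal{L}_{a^b})$ (well defined since $\ker\mathcal{L}=\{a:{}^au=u\ \forall u\in G\}$). Retraction $\mathrm{Ret}(X,r)=(X/\!\sim,r_{[X]})$, $x\sim y$ iff ${}^xz={}^yz$ for all $z$, $r_{[X]}([x],[y])=([{}^xy],[x^y])$; $\mathrm{mpl}(X,r)=m$ if $m$ is minimal with $\mathrm{Ret}^m(X,r)$ a one-element set (then $(X,r)$ is a multipermutation solution); the mpl of a symmetric group is its mpl as a symmetric set. *)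

theory Defs
  imports "HOL-Algebra.Group"
begin

definition r12 :: "('a \<times> 'a \<Rightarrow> 'a \<times> 'a) \<Rightarrow> 'a \<times> 'a \<times> 'a \<Rightarrow> 'a \<times> 'a \<times> 'a" where
  "r12 r t = (case t of (x, y, z) \<Rightarrow> (fst (r (x, y)), snd (r (x, y)), z))"

definition r23 :: "('a \<times> 'a \<Rightarrow> 'a \<times> 'a) \<Rightarrow> 'a \<times> 'a \<times> 'a \<Rightarrow> 'a \<times> 'a \<times> 'a" where
  "r23 r t = (case t of (x, y, z) \<Rightarrow> (x, fst (r (y, z)), snd (r (y, z))))"

text \<open>r(x,y) = (fst (r(x,y)), snd (r(x,y))) = (left action of x on y, right action of y on x).\<close>
definition symset :: "'a set \<Rightarrow> ('a \<times> 'a \<Rightarrow> 'a \<times> 'a) \<Rightarrow> bool" where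
  "symset X r \<longleftrightarrow> X \<noteq> {}
     \<and> bij_betw r (X \<times> X) (X \<times> X)
     \<and> (\<forall>x\<in>X. bij_betw (\<lambda>y. fst (r (x, y))) X X)
     \<and> (\<forall>x\<in>X. bij_betw (\<lambda>y. snd (r (y, x))) X X)
     \<and> (\<forall>x\<in>X. \<forall>y\<in>X. r (r (x, y)) = (x, y))
     \<and> (\<forall>x\<in>X. \<forall>y\<in>X. \<forall>z\<in>X.
          r12 r (r23 r (r12 r (x, y, z))) = r23 r (r12 r (r23 r (x, y, z))))"

definition square_free :: "'a set \<Rightarrow> ('a \<times> 'a \<Rightarrow> 'a \<times> 'a) \<Rightarrow> bool" where
  "square_free X r \<longleftrightarrow> (\<forall>x\<in>X. r (x, x) = (x, x))"

definition cond_star :: "'a set \<Rightarrow> ('a \<times> 'a \<Rightarrow> 'a \<times> 'a) \<Rightarrow> bool" where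
  "cond_star X r \<longleftrightarrow> (\<forall>x\<in>X. \<exists>a\<in>X. fst (r (a, x)) = x)"

definition ret_rel :: "'a set \<Rightarrow> ('a \<times> 'a \<Rightarrow> 'a \<times> 'a) \<Rightarrow> 'a \<Rightarrow> 'a \<Rightarrow> bool" where
  "ret_rel X r x y \<longleftrightarrow> (\<forall>z\<in>X. fst (r (x, z)) = fst (r (y, z)))"

text \<open>Each equivalence class [x] is represented by a canonically chosen element of it,
  so that the retraction lives on the same type (an isomorphic copy of X/~).\<close>
definition ret_rep :: "'a set \<Rightarrow> ('a \<times> 'a \<Rightarrow> 'a \<times> 'a) \<Rightarrow> 'a \<Rightarrow> 'a" where
  "ret_rep X r x = (SOME y. y \<in> X \<and> ret_rel X r y x)"

definition Ret :: "'a set \<times> ('a \<times> 'a \<Rightarrow> 'a \<times> 'a) \<Rightarrow> 'a set \<times> ('a \<times> 'a \<Rightarrow> 'a \<times> 'a)" where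
  "Ret S = (let X = fst S; r = snd S in
     (ret_rep X r ` X,
      \<lambda>p. (ret_rep X r (fst (r p)), ret_rep X r (snd (r p)))))"

definition is_mp :: "'a set \<Rightarrow> ('a \<times> 'a \<Rightarrow> 'a \<times> 'a) \<Rightarrow> bool" where
  "is_mp X r \<longleftrightarrow> (\<exists>m. card (fst ((Ret ^^ m) (X, r))) = 1)"

definition mpl :: "'a set \<Rightarrow> ('a \<times> 'a \<Rightarrow> 'a \<times> 'a) \<Rightarrow> nat" where
  "mpl X r = (LEAST m. card (fst ((Ret ^^ m) (X, r))) = 1)"

type_synonym 'a word = "('a \<times> bool) list"  (* (x,True) = x, (x,False) = x^-1 *)

definition wordX :: "'a set \<Rightarrow> 'a word set" where
  "wordX X = {w. fst ` set w \<subseteq> X}"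

inductive grel :: "'a set \<Rightarrow> ('a \<times> 'a \<Rightarrow> 'a \<times> 'a) \<Rightarrow> 'a word \<Rightarrow> 'a word \<Rightarrow> bool"
  for X r where
  grefl: "w \<in> wordX X \<Longrightarrow> grel X r w w"
| gsym: "grel X r u v \<Longrightarrow> grel X r v u"
| gtrans: "grel X r u v \<Longrightarrow> grel X r v w \<Longrightarrow> grel X r u w"
| gcancel: "u \<in> wordX X \<Longrightarrow> v \<in> wordX X \<Longrightarrow> x \<in> X \<Longrightarrow>
     grel X r (u @ [(x, b), (x, \<not> b)] @ v) (u @ v)"
| grelation: "u \<in> wordX X \<Longrightarrow> v \<in> wordX X \<Longrightarrow> x \<in> X \<Longrightarrow> y \<in> X \<Longrightarrow>
     grel X r (u @ [(x, True), (y, True)] @ v)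
              (u @ [(fst (r (x, y)), True), (snd (r (x, y)), True)] @ v)"

definition gclass :: "'a set \<Rightarrow> ('a \<times> 'a \<Rightarrow> 'a \<times> 'a) \<Rightarrow> 'a word \<Rightarrow> 'a word set" where
  "gclass X r w = {v. grel X r w v}"

definition Gpres :: "'a set \<Rightarrow> ('a \<times> 'a \<Rightarrow> 'a \<times> 'a) \<Rightarrow> 'a word set monoid" where
  "Gpres X r = \<lparr> carrier = gclass X r ` wordX X,
                 mult = (\<lambda>c d. gclass X r ((SOME w. w \<in> c) @ (SOME w. w \<in> d))),
                 one = gclass X r [] \<rparr>"

definition gen :: "'a set \<Rightarrow> ('a \<times> 'a \<Rightarrow> 'a \<times> 'a) \<Rightarrow> 'a \<Rightarrow> 'a word set" where
  "gen X r x = gclass X r [(x, True)]"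

definition symgroup :: "('g, 'b) monoid_scheme \<Rightarrow> ('g \<times> 'g \<Rightarrow> 'g \<times> 'g) \<Rightarrow> bool" where
  "symgroup G \<sigma> \<longleftrightarrow> group G
     \<and> bij_betw \<sigma> (carrier G \<times> carrier G) (carrier G \<times> carrier G)
     \<and> (\<forall>p\<in>carrier G \<times> carrier G. \<sigma> (\<sigma> p) = p)
     \<and> (\<forall>a\<in>carrier G. \<forall>b\<in>carrier G. \<forall>u\<in>carrier G. \<forall>v\<in>carrier G.
          (let la = (\<lambda>x y. fst (\<sigma> (x, y))); ra = (\<lambda>x y. snd (\<sigma> (x, y))) in
            la a \<one>\<^bsub>G\<^esub> = \<one>\<^bsub>G\<^esub>
          \<and> la \<one>\<^bsub>G\<^esub> u = u
          \<and> ra \<one>\<^bsub>G\<^esub> u = \<one>\<^bsub>G\<^esub>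
          \<and> ra a \<one>\<^bsub>G\<^esub> = a
          \<and> la (a \<otimes>\<^bsub>G\<^esub> b) u = la a (la b u)
          \<and> ra a (u \<otimes>\<^bsub>G\<^esub> v) = ra (ra a u) v
          \<and> la a (u \<otimes>\<^bsub>G\<^esub> v) = la a u \<otimes>\<^bsub>G\<^esub> la (ra a u) v
          \<and> ra (a \<otimes>\<^bsub>G\<^esub> b) u = ra a (la b u) \<otimes>\<^bsub>G\<^esub> ra b u
          \<and> u \<otimes>\<^bsub>G\<^esub> v = la u v \<otimes>\<^bsub>G\<^esub> ra u v))"

definition rG :: "'a set \<Rightarrow> ('a \<times> 'a \<Rightarrow> 'a \<times> 'a) \<Rightarrow> ('a word set \<times> 'a word set \<Rightarrow> 'a word set \<times> 'a word set)" where
  "rG X r = (THE \<sigma>. symgroup (Gpres X r) \<sigma>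
      \<and> (\<forall>p. p \<notin> carrier (Gpres X r) \<times> carrier (Gpres X r) \<longrightarrow> \<sigma> p = p)
      \<and> (\<forall>x\<in>X. \<forall>y\<in>X. \<sigma> (gen X r x, gen X r y) =
            (gen X r (fst (r (x, y))), gen X r (snd (r (x, y))))))"

text \<open>Permutations of X are represented as functions that are the identity outside X.\<close>
definition Lgen :: "'a set \<Rightarrow> ('a \<times> 'a \<Rightarrow> 'a \<times> 'a) \<Rightarrow> 'a \<Rightarrow> 'a \<Rightarrow> 'a" where
  "Lgen X r x = (\<lambda>y. if y \<in> X then fst (r (x, y)) else y)"

definition Lgen_inv :: "'a set \<Rightarrow> ('a \<times> 'a \<Rightarrow> 'a \<times> 'a) \<Rightarrow> 'a \<Rightarrow> 'a \<Rightarrow> 'a" where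
  "Lgen_inv X r x = (\<lambda>y. if y \<in> X then (THE z. z \<in> X \<and> fst (r (x, z)) = y) else y)"

fun Lword :: "'a set \<Rightarrow> ('a \<times> 'a \<Rightarrow> 'a \<times> 'a) \<Rightarrow> 'a word \<Rightarrow> 'a \<Rightarrow> 'a" where
  "Lword X r [] = id"
| "Lword X r ((x, b) # w) = (if b then Lgen X r x else Lgen_inv X r x) \<circ> Lword X r w"

text \<open>The homomorphism \<L> : G \<rightarrow> Sym(X) extending x \<mapsto> (y \<mapsto> ^x y).\<close>
definition LG :: "'a set \<Rightarrow> ('a \<times> 'a \<Rightarrow> 'a \<times> 'a) \<Rightarrow> 'a word set \<Rightarrow> 'a \<Rightarrow> 'a" where
  "LG X r c = Lword X r (SOME w. w \<in> c)"

definition Gperm :: "'a set \<Rightarrow> ('a \<times> 'a \<Rightarrow> 'a \<times> 'a) \<Rightarrow> ('a \<Rightarrow> 'a) set" where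
  "Gperm X r = LG X r ` carrier (Gpres X r)"

definition LG_pre :: "'a set \<Rightarrow> ('a \<times> 'a \<Rightarrow> 'a \<times> 'a) \<Rightarrow> ('a \<Rightarrow> 'a) \<Rightarrow> 'a word set" where
  "LG_pre X r p = (SOME a. a \<in> carrier (Gpres X r) \<and> LG X r a = p)"

definition r_perm :: "'a set \<Rightarrow> ('a \<times> 'a \<Rightarrow> 'a \<times> 'a) \<Rightarrow> ('a \<Rightarrow> 'a) \<times> ('a \<Rightarrow> 'a) \<Rightarrow> ('a \<Rightarrow> 'a) \<times> ('a \<Rightarrow> 'a)" where
  "r_perm X r pq = (let a = LG_pre X r (fst pq); b = LG_pre X r (snd pq); s = rG X r (a, b) in
      (LG X r (fst s), LG X r (snd s)))"

end

(* The structure group G acts on the group of integer-valued functions on X by permuting the basis,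
   and x |-> e_x extends to an injective 1-cocycle from G to it; transporting the addition along
   this cocycle makes G a brace generated additively by X, which gives the braiding on G. Let I_0 = 0
   and let I_(m+1) be the set of a acting trivially modulo I_m. These are ideals, and two elements of
   G (of X) are identified in the m-th retraction iff their difference lies in I_m. On the permutation
   group the m-th retraction corresponds to I_(m+1).
   If all x - y (x, y in X) lie in I_m, then elements of G act equally on X modulo I_m, so
   I_(m+1) is everything. If moreover every z in X is fixed by some a in X, then for m > 0 each
   x in X acts on z like a modulo I_(m-1), that is trivially, so x lies in I_m and already I_m is
   everything. *)
theory Submission
  imports Defs "HOL-Library.Function_Algebras" "HOL-Combinatorics.Permutations"
begin

section \<open>Iterated retractions\<close>

text \<open>The group \<open>G\<close> is given by a presentation without normal forms, so
  injectivity of the cocycle is the real obstacle. It is met by building the translations of the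
  additive group directly on \<open>G\<close>, as right multiplications by a suitable generator or
  inverse generator. They commute and are invertible, and every element arises from 1 by
  translations; hence an element depends only on the signed number of translations by each
  generator, and these numbers are its cocycle values. Inverse translations rest on the bijectivity
  of x |-> L_x^(-1) x, which follows from non-degeneracy and involutivity without any counting, so X
  may be infinite. Two choices made in the definitions also need care. A retraction consists of
  arbitrarily chosen representatives, so the m-th one is pulled back to the relation
  \<open>iter_ret_rel\<close> on the original set. The braiding of \<open>G\<close> is a definite
  description, so besides existence it must be shown that the values on generators determine all of
  it.\<close>

primrec iter_ret_rel :: "'a set \<Rightarrow> ('a \<Rightarrow> 'a \<Rightarrow> 'a) \<Rightarrow> nat \<Rightarrow> 'a \<Rightarrow> 'a \<Rightarrow> bool" where
  "iter_ret_rel X f 0 x y \<longleftrightarrow> x = y"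
| "iter_ret_rel X f (Suc m) x y \<longleftrightarrow> (\<forall>z\<in>X. iter_ret_rel X f m (f x z) (f y z))"

lemma iter_ret_rel_refl: "iter_ret_rel X f m x x"
  by (induction m arbitrary: x) auto

lemma iter_ret_rel_trans:
  "iter_ret_rel X f m x y \<Longrightarrow> iter_ret_rel X f m y z \<Longrightarrow> iter_ret_rel X f m x z"
proof (induction m arbitrary: x y z)
  case (Suc m)
  then show ?case
    unfolding iter_ret_rel.simps by blast
qed simp

lemma iter_ret_rel_mono: "iter_ret_rel X f m x y \<Longrightarrow> iter_ret_rel X f (Suc m) x y"
  by (induction m arbitrary: x y) (auto simp: iter_ret_rel_refl)

lemma ret_rep_props:
  assumes "x \<in> X"
  shows "ret_rep X r x \<in> X" "ret_rel X r (ret_rep X r x) x"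
proof -
  have "\<exists>y. y \<in> X \<and> ret_rel X r y x"
    using assms unfolding ret_rel_def by blast
  from someI_ex[OF this] show "ret_rep X r x \<in> X" "ret_rel X r (ret_rep X r x) x"
    unfolding ret_rep_def by auto
qed

lemma ret_rep_eq_iff:
  assumes "x \<in> X" "y \<in> X"
  shows "ret_rep X r x = ret_rep X r y \<longleftrightarrow> ret_rel X r x y"
proof
  assume eq: "ret_rep X r x = ret_rep X r y"
  have "ret_rel X r (ret_rep X r x) x" "ret_rel X r (ret_rep X r x) y"
    using ret_rep_props(2)[OF assms(1), of r] ret_rep_props(2)[OF assms(2), of r] eq by simp_all
  then show "ret_rel X r x y"
    unfolding ret_rel_def by metis
next
  assume "ret_rel X r x y"
  then have "(\<lambda>w. w \<in> X \<and> ret_rel X r w x) = (\<lambda>w. w \<in> X \<and> ret_rel X r w y)"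
    unfolding ret_rel_def by auto
  then show "ret_rep X r x = ret_rep X r y"
    unfolding ret_rep_def by simp
qed

text \<open>Left multiplication has to respect every level of the relation: otherwise the operation
  of a retraction, evaluated at chosen representatives, would depend on the choice. The condition
  speaks of left actions since \<open>ret_rel\<close> does.\<close>

locale left_congruent =
  fixes X :: "'a set" and r :: "'a \<times> 'a \<Rightarrow> 'a \<times> 'a"
  assumes nonempty: "X \<noteq> {}"
    and closed: "x \<in> X \<Longrightarrow> y \<in> X \<Longrightarrow> fst (r (x, y)) \<in> X"
    and cong: "x \<in> X \<Longrightarrow> y \<in> X \<Longrightarrow> y' \<in> X \<Longrightarrow>
        iter_ret_rel X (\<lambda>x y. fst (r (x, y))) m y y' \<Longrightarrow>
        iter_ret_rel X (\<lambda>x y. fst (r (x, y))) m (fst (r (x, y))) (fst (r (x, y')))"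
begin

abbreviation "R \<equiv> iter_ret_rel X (\<lambda>x y. fst (r (x, y)))"

text \<open>Replacing the left factor loses one level, since level m+1 compares left actions at
  level m; monotonicity supplies that extra level beforehand.\<close>

lemma cong2:
  assumes "x \<in> X" "x' \<in> X" "y \<in> X" "y' \<in> X" "R m x x'" "R m y y'"
  shows "R m (fst (r (x, y))) (fst (r (x', y')))"
proof -
  have "R m (fst (r (x, y))) (fst (r (x', y)))"
    using iter_ret_rel_mono[OF assms(5)] assms(3) by auto
  then show ?thesis
    using cong[OF assms(2-4,6)] by (rule iter_ret_rel_trans)
qed

text \<open>The map \<open>q\<close> is the composite projection to the m-th retraction. Its
  compatibility with left actions is carried along because the next \<open>ret_rel\<close> tests
  classes on elements of the form \<open>q z\<close>.\<close>

lemma iterated_quotient: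
  "\<exists>q. q ` X = fst ((Ret ^^ m) (X, r))
     \<and> (\<forall>x\<in>X. \<forall>y\<in>X. q x = q y \<longleftrightarrow> R m x y)
     \<and> (\<forall>x\<in>X. \<forall>y\<in>X. fst (snd ((Ret ^^ m) (X, r)) (q x, q y)) = q (fst (r (x, y))))"
proof (induction m)
  case 0
  show ?case by (rule exI[of _ id]) auto
next
  case (Suc m)
  obtain Y s where Ys: "(Ret ^^ m) (X, r) = (Y, s)"
    by fastforce
  from Suc obtain q where q: "q ` X = Y"
    and qeq: "\<And>x y. x \<in> X \<Longrightarrow> y \<in> X \<Longrightarrow> q x = q y \<longleftrightarrow> R m x y"
    and qhom: "\<And>x y. x \<in> X \<Longrightarrow> y \<in> X \<Longrightarrow> fst (s (q x, q y)) = q (fst (r (x, y)))"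
    unfolding Ys by auto
  define p where "p = ret_rep Y s \<circ> q"
  have qY: "q x \<in> Y" if "x \<in> X" for x
    using q that by auto
  have rel: "ret_rel Y s (q x) (q y) \<longleftrightarrow> R (Suc m) x y" if "x \<in> X" "y \<in> X" for x y
    using that by (auto simp: ret_rel_def q[symmetric] qhom qeq closed)
  have peq: "p x = p y \<longleftrightarrow> R (Suc m) x y" if "x \<in> X" "y \<in> X" for x y
    using that rel[OF that] ret_rep_eq_iff[OF qY qY] by (simp add: p_def)
  \<comment> \<open>The next operation is evaluated at the representatives \<open>p x\<close>, so
    each of them is written as \<open>q x'\<close> with x' equivalent to x at level m+1.\<close>
  have lift: "\<exists>x'\<in>X. p x = q x' \<and> R (Suc m) x' x" if "x \<in> X" for x
  proof -
    have "p x \<in> Y" "ret_rel Y s (p x) (q x)"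
      using ret_rep_props[OF qY[OF that], of s] by (simp_all add: p_def)
    then obtain x' where "x' \<in> X" "p x = q x'"
      using q by auto
    with \<open>ret_rel Y s (p x) (q x)\<close> rel[of x' x] that show ?thesis
      by metis
  qed
  have hom: "ret_rep Y s (fst (s (p x, p y))) = p (fst (r (x, y)))" if xy: "x \<in> X" "y \<in> X" for x y
  proof -
    obtain x' where x': "x' \<in> X" "p x = q x'" "R (Suc m) x' x"
      using lift[OF xy(1)] by blast
    obtain y' where y': "y' \<in> X" "p y = q y'" "R (Suc m) y' y"
      using lift[OF xy(2)] by blast
    have "ret_rep Y s (fst (s (p x, p y))) = p (fst (r (x', y')))"
      using x' y' qhom by (simp add: p_def)
    also have "\<dots> = p (fst (r (x, y)))"
      using peq cong2[OF x'(1) xy(1) y'(1) xy(2) x'(3) y'(3)] closed x' y' xy by blast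
    finally show ?thesis .
  qed
  have "p ` X = ret_rep Y s ` Y"
    by (auto simp: p_def q[symmetric])
  moreover have "(Ret ^^ Suc m) (X, r) = (ret_rep Y s ` Y,
      \<lambda>a. (ret_rep Y s (fst (s a)), ret_rep Y s (snd (s a))))"
    using Ys by (simp add: Ret_def)
  ultimately show ?case
    using peq hom by (intro exI[of _ p]) (simp del: funpow.simps)
qed

lemma card_Ret_eq_1_iff:
  "card (fst ((Ret ^^ m) (X, r))) = 1 \<longleftrightarrow> (\<forall>x\<in>X. \<forall>y\<in>X. R m x y)"
proof -
  obtain q where q: "q ` X = fst ((Ret ^^ m) (X, r))"
    "\<And>x y. x \<in> X \<Longrightarrow> y \<in> X \<Longrightarrow> q x = q y \<longleftrightarrow> R m x y"
    using iterated_quotient[of m] by blast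
  obtain x0 where x0: "x0 \<in> X"
    using nonempty by blast
  have "card (q ` X) = 1 \<longleftrightarrow> (\<forall>x\<in>X. \<forall>y\<in>X. q x = q y)"
  proof
    assume "card (q ` X) = 1"
    then show "\<forall>x\<in>X. \<forall>y\<in>X. q x = q y"
      by (metis card_1_singletonE imageI singletonD)
  next
    assume "\<forall>x\<in>X. \<forall>y\<in>X. q x = q y"
    then have "q ` X = {q x0}"
      using x0 by blast
    then show "card (q ` X) = 1"
      by simp
  qed
  then show ?thesis
    using q by simp
qed

end

section \<open>Bijective cocycles and their ideals\<close>

text \<open>\<open>act_coc\<close> stands in for surjectivity onto the whole additive group: with
  \<open>coc_mult\<close> it makes the image \<open>P\<close> an additive subgroup, so that addition
  can be transported to \<open>G\<close>.\<close>

locale bijective_cocycle = group G for G (structure) +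
  fixes act :: "'b \<Rightarrow> 'c::ab_group_add \<Rightarrow> 'c" and coc :: "'b \<Rightarrow> 'c"
  assumes act_add: "a \<in> carrier G \<Longrightarrow> act a (u + v) = act a u + act a v"
    and act_mult: "a \<in> carrier G \<Longrightarrow> b \<in> carrier G \<Longrightarrow> act (a \<otimes> b) u = act a (act b u)"
    and act_one: "act \<one> u = u"
    and coc_mult: "a \<in> carrier G \<Longrightarrow> b \<in> carrier G \<Longrightarrow> coc (a \<otimes> b) = coc a + act a (coc b)"
    and coc_inj: "inj_on coc (carrier G)"
    and act_coc: "a \<in> carrier G \<Longrightarrow> b \<in> carrier G \<Longrightarrow> act a (coc b) \<in> coc ` carrier G"
begin

abbreviation "P \<equiv> coc ` carrier G"

definition lact :: "'b \<Rightarrow> 'b \<Rightarrow> 'b" where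
  "lact a b = inv_into (carrier G) coc (act a (coc b))"

text \<open>Forced by the axiom that u v is the product of the left and the right action.\<close>

definition ract :: "'b \<Rightarrow> 'b \<Rightarrow> 'b" where
  "ract a b = inv (lact a b) \<otimes> (a \<otimes> b)"

lemma lact_closed [simp]: "a \<in> carrier G \<Longrightarrow> b \<in> carrier G \<Longrightarrow> lact a b \<in> carrier G"
  unfolding lact_def by (intro inv_into_into act_coc)

lemma coc_lact: "a \<in> carrier G \<Longrightarrow> b \<in> carrier G \<Longrightarrow> coc (lact a b) = act a (coc b)"
  unfolding lact_def by (intro f_inv_into_f act_coc)

lemma ract_closed [simp]: "a \<in> carrier G \<Longrightarrow> b \<in> carrier G \<Longrightarrow> ract a b \<in> carrier G"
  by (simp add: ract_def)

lemma coc_eqD: "coc a = coc b \<Longrightarrow> a \<in> carrier G \<Longrightarrow> b \<in> carrier G \<Longrightarrow> a = b"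
  using coc_inj by (auto dest: inj_onD)

lemma act_zero: "a \<in> carrier G \<Longrightarrow> act a 0 = 0"
  using act_add[of a 0 0] by simp

lemma act_uminus: "a \<in> carrier G \<Longrightarrow> act a (- u) = - act a u"
  using act_add[of a u "- u"] act_zero by (simp add: eq_neg_iff_add_eq_0 add.commute)

lemma act_diff: "a \<in> carrier G \<Longrightarrow> act a (u - v) = act a u - act a v"
  using act_add[of a u "- v"] act_uminus[of a v] by simp

lemma act_inv_act: "a \<in> carrier G \<Longrightarrow> act (inv a) (act a u) = u"
  using act_mult[of "inv a" a u] act_one by simp

lemma act_act_inv: "a \<in> carrier G \<Longrightarrow> act a (act (inv a) u) = u"
  using act_mult[of a "inv a" u] act_one by simp

lemma coc_one: "coc \<one> = 0"
  using coc_mult[of \<one> \<one>] act_one by simp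

lemma coc_inv: "a \<in> carrier G \<Longrightarrow> coc (inv a) = - act (inv a) (coc a)"
  using coc_mult[of "inv a" a] coc_one by (simp add: eq_neg_iff_add_eq_0)

lemma uminus_coc: "a \<in> carrier G \<Longrightarrow> - coc a = act a (coc (inv a))"
  by (simp add: coc_inv act_uminus act_act_inv)

section \<open>The braiding attached to a bijective cocycle\<close>

lemma lact_mult_ract: "a \<in> carrier G \<Longrightarrow> b \<in> carrier G \<Longrightarrow> lact a b \<otimes> ract a b = a \<otimes> b"
  by (simp add: ract_def m_assoc[symmetric])

lemma lact_one_left: "u \<in> carrier G \<Longrightarrow> lact \<one> u = u"
  by (intro coc_eqD) (simp_all add: coc_lact act_one)

lemma lact_one_right: "a \<in> carrier G \<Longrightarrow> lact a \<one> = \<one>"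
  by (intro coc_eqD) (simp_all add: coc_lact coc_one act_zero)

lemma lact_mult_left:
  "a \<in> carrier G \<Longrightarrow> b \<in> carrier G \<Longrightarrow> u \<in> carrier G \<Longrightarrow> lact (a \<otimes> b) u = lact a (lact b u)"
  by (intro coc_eqD) (simp_all add: coc_lact act_mult)

lemma lact_mult_right:
  assumes "a \<in> carrier G" "u \<in> carrier G" "v \<in> carrier G"
  shows "lact a (u \<otimes> v) = lact a u \<otimes> lact (ract a u) v"
proof (rule coc_eqD)
  have "act (lact a u) (act (ract a u) (coc v)) = act (a \<otimes> u) (coc v)"
    using assms by (simp add: act_mult[symmetric] lact_mult_ract)
  then show "coc (lact a (u \<otimes> v)) = coc (lact a u \<otimes> lact (ract a u) v)"
    using assms by (simp add: coc_lact coc_mult act_add act_mult)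
qed (use assms in simp_all)

text \<open>Involutivity is commutativity of addition: the value at u v is both
  \<open>coc u + coc (lact u v)\<close> and
  \<open>coc (lact u v) + coc (lact (lact u v) (ract u v))\<close>, and the common summand
  cancels.\<close>

lemma lact_lact_ract:
  assumes "u \<in> carrier G" "v \<in> carrier G"
  shows "lact (lact u v) (ract u v) = u"
proof (rule coc_eqD)
  have "coc (lact u v) + act (lact u v) (coc (ract u v)) = coc (u \<otimes> v)"
    using assms by (simp add: coc_mult[symmetric] lact_mult_ract)
  then show "coc (lact (lact u v) (ract u v)) = coc u"
    using assms by (simp add: coc_lact coc_mult)
qed (use assms in simp_all)

text \<open>The identity outside the carrier matches the normalisation in \<open>rG\<close>, which
  makes the definite description there unique.\<close>

definition braiding :: "'b \<times> 'b \<Rightarrow> 'b \<times> 'b" where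
  "braiding p = (if p \<in> carrier G \<times> carrier G
     then (lact (fst p) (snd p), ract (fst p) (snd p)) else p)"

lemma braiding_eq:
  "a \<in> carrier G \<Longrightarrow> b \<in> carrier G \<Longrightarrow> braiding (a, b) = (lact a b, ract a b)"
  by (simp add: braiding_def)

lemma braiding_involutive:
  "p \<in> carrier G \<times> carrier G \<Longrightarrow> braiding (braiding p) = p"
  by (auto simp: braiding_eq lact_lact_ract ract_def[of "lact _ _"] lact_mult_ract
      m_assoc[symmetric])

lemma symgroup_braiding: "symgroup G braiding"
proof -
  have cl: "braiding p \<in> carrier G \<times> carrier G" if "p \<in> carrier G \<times> carrier G" for p
    using that by (auto simp: braiding_eq)
  have bij: "bij_betw braiding (carrier G \<times> carrier G) (carrier G \<times> carrier G)"
    by (rule bij_betwI[where g = braiding]) (use cl in \<open>auto simp: braiding_involutive\<close>)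
  have one: "ract \<one> u = \<one>" if "u \<in> carrier G" for u
    using that by (simp add: ract_def lact_one_left)
  have rmult: "ract a (u \<otimes> v) = ract (ract a u) v"
    if "a \<in> carrier G" "u \<in> carrier G" "v \<in> carrier G" for a u v
    using that by (simp add: ract_def[of a "u \<otimes> v"] ract_def[of "ract a u"] lact_mult_right
        inv_mult_group) (simp add: ract_def m_assoc)
  have lmult: "ract (a \<otimes> b) u = ract a (lact b u) \<otimes> ract b u"
    if "a \<in> carrier G" "b \<in> carrier G" "u \<in> carrier G" for a b u
  proof -
    have "ract a (lact b u) \<otimes> ract b u = inv (lact a (lact b u)) \<otimes> (a \<otimes> (lact b u \<otimes> ract b u))"
      using that by (simp add: ract_def[of a] m_assoc)
    then show ?thesis
      using that by (simp add: lact_mult_ract ract_def[of "a \<otimes> b"] lact_mult_left m_assoc)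
  qed
  show ?thesis
    unfolding symgroup_def Let_def
    using bij is_group
    by (auto simp: braiding_involutive braiding_eq lact_one_left lact_one_right one rmult lmult
        lact_mult_left lact_mult_right lact_mult_ract ract_def[of _ \<one>])
qed

section \<open>The socle series, recorded by cocycle values so that additive differences can be
  tested\<close>

primrec ideal_seq :: "nat \<Rightarrow> 'c set" where
  "ideal_seq 0 = {0}"
| "ideal_seq (Suc m) = coc ` {a \<in> carrier G. \<forall>z\<in>P. act a z - z \<in> ideal_seq m}"

lemma coc_in_ideal_seq_Suc:
  "a \<in> carrier G \<Longrightarrow> coc a \<in> ideal_seq (Suc m) \<longleftrightarrow> (\<forall>z\<in>P. act a z - z \<in> ideal_seq m)"
  by (auto dest: coc_eqD)

text \<open>A brace ideal in additive form. The last clause replaces normality in the multiplicative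
  group: by \<open>coc_conj\<close> the two conditions are equivalent for an additive subgroup
  stable under the action.\<close>

definition cocycle_ideal :: "'c set \<Rightarrow> bool" where
  "cocycle_ideal I \<longleftrightarrow> I \<subseteq> P \<and> 0 \<in> I \<and> (\<forall>u\<in>I. \<forall>v\<in>I. u + v \<in> I) \<and> (\<forall>u\<in>I. - u \<in> I)
     \<and> (\<forall>a\<in>carrier G. \<forall>u\<in>I. act a u \<in> I)
     \<and> (\<forall>a\<in>carrier G. coc a \<in> I \<longrightarrow> (\<forall>z\<in>P. act a z - z \<in> I))"

text \<open>Measures how far conjugation by \<open>c\<close> is from acting by \<open>c\<close>; the
  error term lies in a stable \<open>I\<close> as soon as \<open>a\<close> acts trivially modulo
  \<open>I\<close>.\<close>

lemma coc_conj:
  assumes "a \<in> carrier G" "c \<in> carrier G"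
  shows "coc (c \<otimes> a \<otimes> inv c) = act c (coc a) + act c (act a (coc (inv c)) - coc (inv c))"
  using assms coc_mult[of c "inv c"]
  by (simp add: coc_mult act_mult act_diff coc_one add_eq_0_iff)

text \<open>The set \<open>S\<close> is visibly a normal subgroup, whereas an ideal needs closure
  under addition and under the action. The bridge is that \<open>I\<close> consists of values of
  elements of \<open>S\<close>, so an error in \<open>I\<close> is absorbed by multiplying with an
  element of \<open>S\<close>. Sums and negatives then come from the action.\<close>

lemma cocycle_ideal_step:
  assumes I: "cocycle_ideal I"
  shows "cocycle_ideal (coc ` {a \<in> carrier G. \<forall>z\<in>P. act a z - z \<in> I})"
proof -
  define S where "S = {a \<in> carrier G. \<forall>z\<in>P. act a z - z \<in> I}"
  have IP: "\<And>u. u \<in> I \<Longrightarrow> u \<in> P" and I0: "0 \<in> I" and Iadd: "\<And>u v. u \<in> I \<Longrightarrow> v \<in> I \<Longrightarrow> u + v \<in> I"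
    and Iminus: "\<And>u. u \<in> I \<Longrightarrow> - u \<in> I"
    and Iact: "\<And>a u. a \<in> carrier G \<Longrightarrow> u \<in> I \<Longrightarrow> act a u \<in> I"
    and Isoc: "\<And>a z. a \<in> carrier G \<Longrightarrow> coc a \<in> I \<Longrightarrow> z \<in> P \<Longrightarrow> act a z - z \<in> I"
    using I unfolding cocycle_ideal_def by blast+
  have SG: "a \<in> carrier G" if "a \<in> S" for a
    using that by (simp add: S_def)
  have Sz: "act a z - z \<in> I" if "a \<in> S" "z \<in> P" for a z
    using that by (auto simp: S_def)
  have SI: "a \<in> S" if "a \<in> carrier G" "\<And>z. z \<in> P \<Longrightarrow> act a z - z \<in> I" for a
    using that by (simp add: S_def)
  have actP: "act a z \<in> P" if "a \<in> carrier G" "z \<in> P" for a z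
    using that act_coc by auto
  have S_of_I: "a \<in> S" if "a \<in> carrier G" "coc a \<in> I" for a
    using that Isoc by (intro SI) auto
  have Smult: "a \<otimes> b \<in> S" if "a \<in> S" "b \<in> S" for a b
  proof (rule SI)
    fix z assume z: "z \<in> P"
    have "act (a \<otimes> b) z - z = (act a (act b z) - act b z) + (act b z - z)"
      using that SG by (simp add: act_mult)
    moreover have "act a (act b z) - act b z \<in> I" "act b z - z \<in> I"
      using that SG z by (auto intro: Sz actP)
    ultimately show "act (a \<otimes> b) z - z \<in> I"
      using Iadd by metis
  qed (use that SG in simp)
  have Sinv: "inv a \<in> S" if "a \<in> S" for a
  proof (rule SI)
    fix z assume z: "z \<in> P"
    have "act (inv a) z - z = - (act a (act (inv a) z) - act (inv a) z)"
      using that SG by (simp add: act_act_inv)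
    moreover have "act a (act (inv a) z) - act (inv a) z \<in> I"
      using that SG z by (intro Sz actP) auto
    ultimately show "act (inv a) z - z \<in> I"
      using Iminus by metis
  qed (use that SG in simp)
  have Sconj: "c \<otimes> a \<otimes> inv c \<in> S" if "a \<in> S" "c \<in> carrier G" for a c
  proof (rule SI)
    fix z assume z: "z \<in> P"
    have "act (c \<otimes> a \<otimes> inv c) z - z = act c (act a (act (inv c) z) - act (inv c) z)"
      using that SG by (simp add: act_mult act_diff act_act_inv)
    moreover have "act a (act (inv c) z) - act (inv c) z \<in> I"
      using that SG z by (intro Sz actP) auto
    ultimately show "act (c \<otimes> a \<otimes> inv c) z - z \<in> I"
      using Iact that by metis
  qed (use that SG in simp)
  \<comment> \<open>Modulo \<open>I\<close> the action of \<open>c\<close> on \<open>S\<close> is conjugation by \<open>c\<close>.\<close>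
  have Sact: "\<exists>d\<in>S. coc d = act c (coc a)" if "a \<in> S" "c \<in> carrier G" for a c
  proof -
    define g where "g = c \<otimes> a \<otimes> inv c"
    define k where "k = act c (act a (coc (inv c)) - coc (inv c))"
    have g: "g \<in> S" "g \<in> carrier G"
      using Sconj[OF that] SG by (simp_all add: g_def)
    have "k \<in> I"
      using that SG by (auto simp: k_def intro!: Iact Sz)
    \<comment> \<open>Subtracting \<open>k\<close> additively is multiplying \<open>g\<close> on the
      right by \<open>d\<close>, because \<open>g\<close> acting on \<open>coc d\<close> gives back
      \<open>- k\<close>.\<close>
    then have m: "act (inv g) (- k) \<in> I"
      using g by (auto intro: Iact Iminus)
    then obtain d where d: "d \<in> carrier G" "coc d = act (inv g) (- k)"
      using IP by (metis imageE)
    then have "d \<in> S"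
      using m S_of_I by simp
    have "coc (g \<otimes> d) = act c (coc a)"
      using g d coc_conj[of a c] that SG
      by (simp add: coc_mult act_act_inv g_def[symmetric] k_def[symmetric])
    then show ?thesis
      using Smult[OF g(1) \<open>d \<in> S\<close>] by blast
  qed
  have add: "\<exists>d\<in>S. coc d = coc a + coc b" if ab: "a \<in> S" "b \<in> S" for a b
  proof -
    obtain d where d: "d \<in> S" "coc d = act (inv a) (coc b)"
      using Sact[OF ab(2), of "inv a"] ab SG by auto
    have "coc (a \<otimes> d) = coc a + coc b"
      using d ab SG by (simp add: coc_mult act_act_inv)
    then show ?thesis
      using Smult[OF ab(1) d(1)] by blast
  qed
  \<comment> \<open>The negative of \<open>coc a\<close> is \<open>a\<close> acting on the value of
    \<open>inv a\<close>, which again belongs to \<open>S\<close>.\<close>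
  have minus: "\<exists>d\<in>S. coc d = - coc a" if "a \<in> S" for a
    using Sact[OF Sinv[OF that] SG[OF that]] uminus_coc[OF SG[OF that]] by simp
  have zero: "\<exists>d\<in>S. coc d = 0"
    using S_of_I[of \<one>] I0 coc_one by force
  have soc: "act a z - z \<in> coc ` S" if "a \<in> carrier G" "coc a \<in> coc ` S" "z \<in> P" for a z
  proof -
    have "a \<in> S"
      using that coc_eqD SG by (metis imageE)
    then have "act a z - z \<in> I"
      using Sz that by blast
    moreover from this obtain d where "d \<in> carrier G" "act a z - z = coc d"
      using IP by (metis imageE)
    ultimately show ?thesis
      using S_of_I by auto
  qed
  have im: "u \<in> coc ` S \<longleftrightarrow> (\<exists>d\<in>S. coc d = u)" for u
    by blast
  show ?thesis
    unfolding S_def[symmetric] cocycle_ideal_def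
  proof (intro conjI ballI impI)
    show "coc ` S \<subseteq> P" using SG by blast
    show "0 \<in> coc ` S" using zero im by simp
    show "u + v \<in> coc ` S" if "u \<in> coc ` S" "v \<in> coc ` S" for u v
      using that add im by fastforce
    show "- u \<in> coc ` S" if "u \<in> coc ` S" for u
      using that minus im by fastforce
    show "act a u \<in> coc ` S" if "a \<in> carrier G" "u \<in> coc ` S" for a u
      using that Sact im by fastforce
    show "act a z - z \<in> coc ` S" if "a \<in> carrier G" "coc a \<in> coc ` S" "z \<in> P" for a z
      using that soc by blast
  qed
qed

lemma cocycle_ideal_seq: "cocycle_ideal (ideal_seq m)"
proof (induction m)
  case 0
  have "act a z - z = 0" if "a \<in> carrier G" "coc a = 0" for a z
    using that coc_eqD[of a \<one>] coc_one act_one by simp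
  moreover have "0 \<in> P"
    using coc_one by (metis imageI one_closed)
  ultimately show ?case
    by (auto simp: cocycle_ideal_def act_zero)
next
  case (Suc m)
  then show ?case
    using cocycle_ideal_step by simp
qed

lemma ideal_seq_zero: "0 \<in> ideal_seq m"
  and ideal_seq_subset: "u \<in> ideal_seq m \<Longrightarrow> u \<in> P"
  and ideal_seq_add: "u \<in> ideal_seq m \<Longrightarrow> v \<in> ideal_seq m \<Longrightarrow> u + v \<in> ideal_seq m"
  and ideal_seq_uminus: "u \<in> ideal_seq m \<Longrightarrow> - u \<in> ideal_seq m"
  and ideal_seq_act: "a \<in> carrier G \<Longrightarrow> u \<in> ideal_seq m \<Longrightarrow> act a u \<in> ideal_seq m"
  and ideal_seq_act_diff:
    "a \<in> carrier G \<Longrightarrow> coc a \<in> ideal_seq m \<Longrightarrow> z \<in> P \<Longrightarrow> act a z - z \<in> ideal_seq m"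
  using cocycle_ideal_seq[of m] unfolding cocycle_ideal_def by blast+

lemma ideal_seq_diff: "u \<in> ideal_seq m \<Longrightarrow> v \<in> ideal_seq m \<Longrightarrow> u - v \<in> ideal_seq m"
  using ideal_seq_add[of u m "- v"] ideal_seq_uminus by simp

lemma ideal_seq_act_iff: "a \<in> carrier G \<Longrightarrow> act a u \<in> ideal_seq m \<longleftrightarrow> u \<in> ideal_seq m"
  using ideal_seq_act[of a u m] ideal_seq_act[of "inv a" "act a u" m] act_inv_act by auto

text \<open>Quotients and differences can be exchanged: the value of
  \<open>inv b \<otimes> a\<close> is the difference moved by \<open>inv b\<close>, and the ideals
  are stable under the action. This turns the retraction condition on left actions into membership
  in the next ideal.\<close>

lemma coc_diff_in_ideal_seq_Suc:
  assumes "a \<in> carrier G" "b \<in> carrier G"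
  shows "coc a - coc b \<in> ideal_seq (Suc m) \<longleftrightarrow> (\<forall>z\<in>P. act a z - act b z \<in> ideal_seq m)"
proof -
  have "coc (inv b \<otimes> a) = act (inv b) (coc a - coc b)"
    using assms by (simp add: coc_mult coc_inv act_diff)
  then have "coc a - coc b \<in> ideal_seq (Suc m) \<longleftrightarrow> coc (inv b \<otimes> a) \<in> ideal_seq (Suc m)"
    using ideal_seq_act_iff[of "inv b" "coc a - coc b" "Suc m"] assms by (simp del: ideal_seq.simps)
  also have "\<dots> \<longleftrightarrow> (\<forall>z\<in>P. act (inv b \<otimes> a) z - z \<in> ideal_seq m)"
    using coc_in_ideal_seq_Suc assms by blast
  also have "\<dots> \<longleftrightarrow> (\<forall>z\<in>P. act a z - act b z \<in> ideal_seq m)"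
  proof -
    have "act (inv b \<otimes> a) z - z = act (inv b) (act a z - act b z)" for z
      using assms by (simp add: act_mult act_diff act_inv_act)
    then show ?thesis
      using ideal_seq_act_iff[of "inv b"] assms by simp
  qed
  finally show ?thesis .
qed

lemma iter_ret_rel_iff:
  assumes "\<And>a b. a \<in> carrier G \<Longrightarrow> b \<in> carrier G \<Longrightarrow> f a b = lact a b"
    and "a \<in> carrier G" "b \<in> carrier G"
  shows "iter_ret_rel (carrier G) f m a b \<longleftrightarrow> coc a - coc b \<in> ideal_seq m"
  using assms(2,3)
proof (induction m arbitrary: a b)
  case 0
  then show ?case
    using coc_eqD by auto
next
  case (Suc m)
  then show ?case
    using coc_diff_in_ideal_seq_Suc[of a b m] assms(1) by (simp add: coc_lact del: ideal_seq.simps)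
qed

end

section \<open>Cocycles over an additive generating set that the group permutes\<close>

locale generated_cocycle = bijective_cocycle G act coc
  for G (structure) and act :: "'b \<Rightarrow> 'c::ab_group_add \<Rightarrow> 'c" and coc +
  fixes X :: "'x set" and i :: "'x \<Rightarrow> 'b" and f :: "'x \<Rightarrow> 'x \<Rightarrow> 'x"
  assumes i_closed: "x \<in> X \<Longrightarrow> i x \<in> carrier G"
    and f_closed: "x \<in> X \<Longrightarrow> y \<in> X \<Longrightarrow> f x y \<in> X"
    and act_gen: "x \<in> X \<Longrightarrow> y \<in> X \<Longrightarrow> act (i x) (coc (i y)) = coc (i (f x y))"
    and inj_gen: "inj_on (\<lambda>x. coc (i x)) X"
    and act_perm: "a \<in> carrier G \<Longrightarrow> x \<in> X \<Longrightarrow> \<exists>y\<in>X. act a (coc (i x)) = coc (i y)"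
    and additive_gen: "0 \<in> Q \<Longrightarrow> (\<And>u v. u \<in> Q \<Longrightarrow> v \<in> Q \<Longrightarrow> u + v \<in> Q) \<Longrightarrow>
        (\<And>u. u \<in> Q \<Longrightarrow> - u \<in> Q) \<Longrightarrow> (\<And>x. x \<in> X \<Longrightarrow> coc (i x) \<in> Q) \<Longrightarrow> P \<subseteq> Q"
begin

text \<open>The elements on which \<open>a\<close> and \<open>b\<close> agree modulo the ideal form
  an additive subgroup, so \<open>additive_gen\<close>, the minimality of the span of X, serves as
  an induction principle.\<close>

lemma act_diff_on_generators:
  assumes "a \<in> carrier G" "b \<in> carrier G"
  shows "(\<forall>z\<in>P. act a z - act b z \<in> ideal_seq m) \<longleftrightarrow>
    (\<forall>x\<in>X. act a (coc (i x)) - act b (coc (i x)) \<in> ideal_seq m)"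
proof
  assume gens: "\<forall>x\<in>X. act a (coc (i x)) - act b (coc (i x)) \<in> ideal_seq m"
  have "P \<subseteq> {z. act a z - act b z \<in> ideal_seq m}"
  proof (rule additive_gen; clarify?)
    show "act a 0 - act b 0 \<in> ideal_seq m"
      using assms ideal_seq_zero by (simp add: act_zero)
  next
    fix u v assume "act a u - act b u \<in> ideal_seq m" "act a v - act b v \<in> ideal_seq m"
    from ideal_seq_add[OF this] show "act a (u + v) - act b (u + v) \<in> ideal_seq m"
      using assms by (simp add: act_add algebra_simps)
  next
    fix u assume "act a u - act b u \<in> ideal_seq m"
    from ideal_seq_uminus[OF this] show "act a (- u) - act b (- u) \<in> ideal_seq m"
      using assms by (simp add: act_uminus)
  qed (use gens in auto)
  then show "\<forall>z\<in>P. act a z - act b z \<in> ideal_seq m"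
    by blast
qed (use i_closed in blast)

text \<open>The retraction of X tests left actions on X, the ideals test them on all of
  \<open>P\<close>. Since \<open>act_diff_on_generators\<close> makes the two tests equal, the
  relation on X is at each level the restriction of the one on \<open>G\<close>.\<close>

lemma iter_ret_rel_generators:
  assumes "x \<in> X" "y \<in> X"
  shows "iter_ret_rel X f m x y \<longleftrightarrow> coc (i x) - coc (i y) \<in> ideal_seq m"
  using assms
proof (induction m arbitrary: x y)
  case 0
  then show ?case
    using inj_gen by (auto dest: inj_onD)
next
  case (Suc m)
  then show ?case
    using coc_diff_in_ideal_seq_Suc[of "i x" "i y" m] act_diff_on_generators[of "i x" "i y" m]
    by (simp add: i_closed f_closed act_gen del: ideal_seq.simps)
qed

lemma ideal_seq_Suc_full:
  assumes "\<And>x y. x \<in> X \<Longrightarrow> y \<in> X \<Longrightarrow> iter_ret_rel X f m x y"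
  shows "P \<subseteq> ideal_seq (Suc m)"
proof clarify
  fix a assume a: "a \<in> carrier G"
  have "act a (coc (i x)) - act \<one> (coc (i x)) \<in> ideal_seq m" if "x \<in> X" for x
  proof -
    obtain y where "y \<in> X" "act a (coc (i x)) = coc (i y)"
      using act_perm[OF a \<open>x \<in> X\<close>] by blast
    then show ?thesis
      using assms[of y x] iter_ret_rel_generators that by (simp add: act_one)
  qed
  then have "coc a - coc \<one> \<in> ideal_seq (Suc m)"
    using act_diff_on_generators[OF a one_closed] coc_diff_in_ideal_seq_Suc[OF a one_closed]
    by blast
  then show "coc a \<in> ideal_seq (Suc m)"
    by (simp add: coc_one)
qed

lemma ideal_seq_full_of_fixing:
  assumes total: "\<And>x y. x \<in> X \<Longrightarrow> y \<in> X \<Longrightarrow> iter_ret_rel X f (Suc m) x y"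
    and fixing: "\<And>x. x \<in> X \<Longrightarrow> \<exists>a\<in>X. f a x = x"
  shows "P \<subseteq> ideal_seq (Suc m)"
proof (rule additive_gen)
  fix x assume x: "x \<in> X"
  have "act (i x) (coc (i z)) - act \<one> (coc (i z)) \<in> ideal_seq m" if z: "z \<in> X" for z
  proof -
    obtain a where a: "a \<in> X" "f a z = z"
      using fixing z by blast
    \<comment> \<open>Unfolding the relation at \<open>z\<close> costs one level, which is why the
      hypothesis starts at a successor.\<close>
    have "iter_ret_rel X f m (f x z) (f a z)"
      using total[OF x a(1)] z by simp
    then show ?thesis
      using a z x iter_ret_rel_generators[of "f x z" z m] f_closed
      by (simp add: act_gen act_one)
  qed
  then have "coc (i x) - coc \<one> \<in> ideal_seq (Suc m)"
    using act_diff_on_generators[OF i_closed[OF x] one_closed]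
      coc_diff_in_ideal_seq_Suc[OF i_closed[OF x] one_closed] by blast
  then show "coc (i x) \<in> ideal_seq (Suc m)"
    by (simp add: coc_one)
qed (use ideal_seq_zero ideal_seq_add ideal_seq_uminus in blast)+

end

section \<open>The structure group\<close>

definition basis_vec :: "'a \<Rightarrow> 'a \<Rightarrow> int" where
  "basis_vec x = (\<lambda>y. if y = x then 1 else 0)"

text \<open>Composition with the inverse makes this a left action that moves the basis vector of x
  to that of p x. Permutations of X are extended by the identity, so the inverse is taken on the
  whole type.\<close>

definition perm_act :: "('a \<Rightarrow> 'a) \<Rightarrow> ('a \<Rightarrow> int) \<Rightarrow> 'a \<Rightarrow> int" where
  "perm_act p v = v \<circ> inv_into UNIV p"

lemma perm_act_id [simp]: "perm_act id v = v"
  by (simp add: perm_act_def)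

lemma perm_act_comp: "bij p \<Longrightarrow> bij q \<Longrightarrow> perm_act (p \<circ> q) v = perm_act p (perm_act q v)"
  by (simp add: perm_act_def o_inv_distrib o_assoc)

lemma perm_act_add: "perm_act p (u + v) = perm_act p u + perm_act p v"
  by (simp add: perm_act_def fun_eq_iff)

lemma perm_act_zero [simp]: "perm_act p 0 = 0"
  by (simp add: perm_act_def fun_eq_iff)

lemma perm_act_uminus: "perm_act p (- u) = - perm_act p u"
  by (simp add: perm_act_def fun_eq_iff)

lemma perm_act_basis_vec: "bij p \<Longrightarrow> perm_act p (basis_vec x) = basis_vec (p x)"
  by (auto simp: perm_act_def basis_vec_def fun_eq_iff bij_inv_eq_iff bij_def)

lemma basis_vec_eq_iff [simp]: "basis_vec x = basis_vec y \<longleftrightarrow> x = y"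
  by (auto simp: basis_vec_def fun_eq_iff split: if_splits)

lemma wordX_simps [simp]:
  "[] \<in> wordX X" "l # w \<in> wordX X \<longleftrightarrow> fst l \<in> X \<and> w \<in> wordX X"
  "u @ v \<in> wordX X \<longleftrightarrow> u \<in> wordX X \<and> v \<in> wordX X"
  by (auto simp: wordX_def)

section \<open>Symmetric sets and their left action\<close>

locale symmetric_set =
  fixes X :: "'a set" and r :: "'a \<times> 'a \<Rightarrow> 'a \<times> 'a"
  assumes symset: "symset X r"
begin

abbreviation "lt x y \<equiv> fst (r (x, y))"
abbreviation "rt x y \<equiv> snd (r (x, y))"

lemma nonempty: "X \<noteq> {}"
  using symset by (simp add: symset_def)

lemma lt_bij: "x \<in> X \<Longrightarrow> bij_betw (lt x) X X"
  using symset by (simp add: symset_def)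

lemma rt_bij: "y \<in> X \<Longrightarrow> bij_betw (\<lambda>x. rt x y) X X"
  using symset by (simp add: symset_def)

lemma lt_closed [simp]: "x \<in> X \<Longrightarrow> y \<in> X \<Longrightarrow> lt x y \<in> X"
  using bij_betwE[OF lt_bij] by blast

lemma rt_closed [simp]: "x \<in> X \<Longrightarrow> y \<in> X \<Longrightarrow> rt x y \<in> X"
  using bij_betwE[OF rt_bij] by blast

lemma r_r: "x \<in> X \<Longrightarrow> y \<in> X \<Longrightarrow> r (lt x y, rt x y) = (x, y)"
  using symset by (simp add: symset_def)

text \<open>First coordinate of the braid relation on triples; it makes x |-> L_x compatible with
  the relations of the group.\<close>

lemma lt_lt_rt:
  assumes "x \<in> X" "y \<in> X" "z \<in> X"
  shows "lt (lt x y) (lt (rt x y) z) = lt x (lt y z)"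
proof -
  have "r12 r (r23 r (r12 r (x, y, z))) = r23 r (r12 r (r23 r (x, y, z)))"
    using symset assms by (simp add: symset_def)
  from arg_cong[OF this, of fst] show ?thesis
    by (simp add: r12_def r23_def case_prod_unfold)
qed

lemma lt_inj:
  assumes "x \<in> X" "y \<in> X" "z \<in> X"
  shows "lt x y = lt x z \<longleftrightarrow> y = z"
  using inj_on_eq_iff[OF bij_betw_imp_inj_on[OF lt_bij[OF assms(1)]] assms(2,3)] .

lemma rt_inj:
  assumes "x \<in> X" "y \<in> X" "z \<in> X"
  shows "rt y x = rt z x \<longleftrightarrow> y = z"
  using inj_on_eq_iff[OF bij_betw_imp_inj_on[OF rt_bij[OF assms(1)]] assms(2,3)] .

lemma rt_surj:
  assumes "y \<in> X" "z \<in> X"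
  shows "\<exists>x\<in>X. rt x y = z"
proof -
  have "z \<in> (\<lambda>x. rt x y) ` X"
    using bij_betw_imp_surj_on[OF rt_bij[OF assms(1)]] assms(2) by simp
  then show ?thesis
    by auto
qed

text \<open>If \<open>lt x y = x\<close>, involutivity says that r maps \<open>(x, rt x y)\<close>
  to \<open>(x, y)\<close>, so \<open>lt x\<close> takes the same value at \<open>rt x y\<close> and
  at \<open>y\<close>. The converse is the mirror image with right actions.\<close>

lemma lt_fixed_iff_rt_fixed:
  assumes "x \<in> X" "y \<in> X"
  shows "lt x y = x \<longleftrightarrow> rt x y = y"
proof
  assume "lt x y = x"
  then show "rt x y = y"
    using r_r[OF assms] lt_inj[OF assms(1), of "rt x y" y] assms by simp
next
  assume "rt x y = y"
  then show "lt x y = x"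
    using r_r[OF assms] rt_inj[OF assms(2), of "lt x y" x] assms by simp
qed

text \<open>In other words, \<open>x \<mapsto> L\<^sub>x\<^sup>-\<^sup>1 x\<close> is a bijection of \<open>X\<close>.\<close>
lemma diagonal_bijective:
  assumes "y \<in> X"
  shows "\<exists>!x. x \<in> X \<and> lt x y = x"
proof -
  obtain x where x: "x \<in> X" "rt x y = y"
    using rt_surj[OF assms assms] by blast
  show ?thesis
  proof (rule ex1I[of _ x])
    fix x' assume x': "x' \<in> X \<and> lt x' y = x'"
    then have "rt x' y = rt x y"
      using x lt_fixed_iff_rt_fixed[of x' y] assms by simp
    then show "x' = x"
      using rt_inj[OF assms, of x' x] x x' by blast
  qed (use x lt_fixed_iff_rt_fixed[of x y] assms in blast)
qed

lemma Lgen_permutes: "x \<in> X \<Longrightarrow> Lgen X r x permutes X"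
proof (rule bij_imp_permutes)
  assume "x \<in> X"
  then have "bij_betw (lt x) X X"
    by (rule lt_bij)
  then show "bij_betw (Lgen X r x) X X"
    by (rule bij_betw_cong[THEN iffD1, rotated]) (simp add: Lgen_def)
qed (simp add: Lgen_def)

lemma Lgen_inv_eq:
  assumes x: "x \<in> X"
  shows "Lgen_inv X r x = inv_into UNIV (Lgen X r x)"
proof
  fix y
  show "Lgen_inv X r x y = inv_into UNIV (Lgen X r x) y"
  proof (cases "y \<in> X")
    case True
    have z: "inv_into UNIV (Lgen X r x) y \<in> X"
      using permutes_in_image[OF permutes_inv[OF Lgen_permutes[OF x]]] True by blast
    have "Lgen X r x (inv_into UNIV (Lgen X r x) y) = y"
      using permutes_inverses(1)[OF Lgen_permutes[OF x]] .
    then have lt: "lt x (inv_into UNIV (Lgen X r x) y) = y"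
      using z by (simp add: Lgen_def)
    have "(THE z. z \<in> X \<and> lt x z = y) = inv_into UNIV (Lgen X r x) y"
      using z lt lt_inj[OF x] by (intro the_equality) auto
    then show ?thesis
      using True by (simp add: Lgen_inv_def)
  next
    case False
    then show ?thesis
      using permutes_inv[OF Lgen_permutes[OF x]] by (simp add: Lgen_inv_def permutes_not_in)
  qed
qed

section \<open>The permutation and the cocycle value of a word\<close>

abbreviation "L \<equiv> Lword X r"

lemma L_append: "L (u @ v) = L u \<circ> L v"
  by (induction u) (auto simp: o_assoc)

lemma L_permutes: "w \<in> wordX X \<Longrightarrow> L w permutes X"
proof (induction w)
  case (Cons l w)
  obtain x b where [simp]: "l = (x, b)" by fastforce
  have "(if b then Lgen X r x else Lgen_inv X r x) permutes X"
    using Cons.prems by (auto simp: Lgen_inv_eq intro: Lgen_permutes permutes_inv)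
  moreover have "L w permutes X"
    using Cons by simp
  ultimately show ?case
    unfolding \<open>l = (x, b)\<close> Lword.simps by (intro permutes_compose)
qed simp

lemma L_bij: "w \<in> wordX X \<Longrightarrow> bij (L w)"
  by (rule permutes_bij[OF L_permutes])

text \<open>The value at an inverse letter is forced by the cocycle rule for x^(-1) x = 1: it is
  minus the basis vector of x moved by the inverse of L_x.\<close>

primrec letter_coc :: "'a \<times> bool \<Rightarrow> 'a \<Rightarrow> int" where
  "letter_coc (x, b) = (if b then basis_vec x else - basis_vec (Lgen_inv X r x x))"

primrec word_coc :: "'a word \<Rightarrow> 'a \<Rightarrow> int" where
  "word_coc [] = 0"
| "word_coc (l # w) = letter_coc l + perm_act (L [l]) (word_coc w)"

lemma word_coc_append:
  "u \<in> wordX X \<Longrightarrow> v \<in> wordX X \<Longrightarrow> word_coc (u @ v) = word_coc u + perm_act (L u) (word_coc v)"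
proof (induction u)
  case (Cons l u)
  have "L (l # u) = L [l] \<circ> L u"
    using L_append[of "[l]" u] by simp
  then have "perm_act (L (l # u)) (word_coc v) = perm_act (L [l]) (perm_act (L u) (word_coc v))"
    using Cons.prems L_bij[of "[l]"] L_bij[of u] by (simp add: perm_act_comp)
  moreover have "word_coc (u @ v) = word_coc u + perm_act (L u) (word_coc v)"
    using Cons by (simp only: wordX_simps)
  ultimately show ?case
    by (simp only: append_Cons perm_act_add word_coc.simps add.assoc)
qed simp

lemma L_cancel: "x \<in> X \<Longrightarrow> L [(x, b), (x, \<not> b)] = id"
  using permutes_inv_o[OF Lgen_permutes[of x]] by (cases b) (auto simp: Lgen_inv_eq)

lemma L_relation:
  assumes "x \<in> X" "y \<in> X"
  shows "L [(x, True), (y, True)] = L [(lt x y, True), (rt x y, True)]"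
  using assms by (auto simp: fun_eq_iff Lgen_def lt_lt_rt)

lemma word_coc_cancel:
  assumes "x \<in> X"
  shows "word_coc [(x, b), (x, \<not> b)] = 0"
proof -
  have "bij (Lgen X r x)"
    using Lgen_permutes[OF assms] permutes_bij by blast
  then show ?thesis
    using assms by (cases b) (auto simp: Lgen_inv_eq perm_act_basis_vec perm_act_uminus
        bij_imp_bij_inv surj_f_inv_f bij_is_surj)
qed

text \<open>Both sides are the sum of the basis vectors of \<open>x\<close> and
  \<open>lt x y\<close>, in opposite orders, since involutivity gives
  \<open>lt (lt x y) (rt x y) = x\<close>.\<close>

lemma word_coc_relation:
  assumes "x \<in> X" "y \<in> X"
  shows "word_coc [(x, True), (y, True)] = word_coc [(lt x y, True), (rt x y, True)]"
proof -
  have b: "bij (Lgen X r z)" if "z \<in> X" for z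
    using Lgen_permutes[OF that] permutes_bij by blast
  have "Lgen X r (lt x y) (rt x y) = x" "Lgen X r x y = lt x y"
    using r_r[OF assms] assms by (simp_all add: Lgen_def)
  then show ?thesis
    using assms by (simp add: b perm_act_basis_vec add.commute)
qed

section \<open>The presenting relation and the group of its classes\<close>

lemma grel_wordX: "grel X r u v \<Longrightarrow> u \<in> wordX X \<and> v \<in> wordX X"
  by (induction rule: grel.induct) auto

lemma grel_L: "grel X r u v \<Longrightarrow> L u = L v"
proof (induction rule: grel.induct)
  case (gcancel u v x b)
  then show ?case
    using L_cancel[of x b] by (simp only: L_append) simp
next
  case (grelation u v x y)
  then show ?case
    using L_relation[of x y] by (simp only: L_append)
qed auto

lemma grel_word_coc: "grel X r u v \<Longrightarrow> word_coc u = word_coc v"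
proof (induction rule: grel.induct)
  case (gcancel u v x b)
  then show ?case
    using L_cancel[of x b] word_coc_cancel[of x b]
    by (simp add: word_coc_append del: word_coc.simps Lword.simps append.simps)
next
  case (grelation u v x y)
  then show ?case
    using L_relation[of x y] word_coc_relation[of x y]
    by (simp add: word_coc_append del: word_coc.simps Lword.simps append.simps)
qed auto

lemma grel_context:
  "grel X r u v \<Longrightarrow> p \<in> wordX X \<Longrightarrow> q \<in> wordX X \<Longrightarrow> grel X r (p @ u @ q) (p @ v @ q)"
proof (induction rule: grel.induct)
  case (gcancel u v x b)
  then show ?case
    using grel.gcancel[of "p @ u" X "v @ q" x r b] by simp
next
  case (grelation u v x y)
  then show ?case
    using grel.grelation[of "p @ u" X "v @ q" x y r] by simp
next
  case (gtrans u v w)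
  then show ?case
    using grel.gtrans by blast
qed (auto intro: grel.grefl grel.gsym)

lemma grel_append: "grel X r u u' \<Longrightarrow> grel X r v v' \<Longrightarrow> grel X r (u @ v) (u' @ v')"
  using grel_context[of u u' "[]" v] grel_context[of v v' u' "[]"]
    grel_wordX[of u u'] grel_wordX[of v v'] grel.gtrans[of X r "u @ v" "u' @ v" "u' @ v'"] by simp

abbreviation "cls \<equiv> gclass X r"

lemma gclass_eq_iff: "u \<in> wordX X \<Longrightarrow> cls u = cls v \<longleftrightarrow> grel X r u v"
proof
  assume "u \<in> wordX X" "cls u = cls v"
  moreover have "v \<in> cls v \<longleftrightarrow> grel X r v v" "v \<in> cls u \<longleftrightarrow> grel X r u v"
    "u \<in> cls v \<longleftrightarrow> grel X r v u" "u \<in> cls u \<longleftrightarrow> grel X r u u"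
    by (simp_all add: gclass_def)
  ultimately show "grel X r u v"
    using grel.grefl[of u X r] by (simp add: grel.gsym)
next
  assume "grel X r u v"
  then have "grel X r u w \<longleftrightarrow> grel X r v w" for w
    using grel.gtrans grel.gsym by metis
  then show "cls u = cls v"
    by (simp add: gclass_def)
qed

lemma grel_rep: "w \<in> wordX X \<Longrightarrow> grel X r w (SOME v. v \<in> gclass X r w)"
  using someI[of "grel X r w" w] grel.grefl[of w X r] by (simp add: gclass_def)

abbreviation "GX \<equiv> Gpres X r"

lemma carrier_GX: "carrier GX = cls ` wordX X"
  by (simp add: Gpres_def)

lemma cls_closed [simp]: "w \<in> wordX X \<Longrightarrow> cls w \<in> carrier GX"
  by (simp add: carrier_GX)

lemma one_GX: "\<one>\<^bsub>GX\<^esub> = cls []"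
  by (simp add: Gpres_def)

lemma mult_cls:
  assumes "u \<in> wordX X" "v \<in> wordX X"
  shows "cls u \<otimes>\<^bsub>GX\<^esub> cls v = cls (u @ v)"
proof -
  have "grel X r (u @ v) ((SOME w. w \<in> cls u) @ (SOME w. w \<in> cls v))"
    by (intro grel_append grel_rep assms)
  then show ?thesis
    using assms gclass_eq_iff[of "u @ v", symmetric] by (simp add: Gpres_def)
qed

lemma grel_inverse: "w \<in> wordX X \<Longrightarrow> grel X r (map (\<lambda>(x, b). (x, \<not> b)) (rev w) @ w) []"
proof (induction w)
  case (Cons l w)
  obtain x b where [simp]: "l = (x, b)" by fastforce
  have "map (\<lambda>(x, b). (x, \<not> b)) (rev w) \<in> wordX X"
    using Cons.prems by (auto simp: wordX_def)
  then have "grel X r (map (\<lambda>(x, b). (x, \<not> b)) (rev (l # w)) @ l # w)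
      (map (\<lambda>(x, b). (x, \<not> b)) (rev w) @ w)"
    using grel.gcancel[of "map (\<lambda>(x, b). (x, \<not> b)) (rev w)" X w x r "\<not> b"] Cons.prems by simp
  moreover have "grel X r (map (\<lambda>(x, b). (x, \<not> b)) (rev w) @ w) []"
    using Cons by simp
  ultimately show ?case
    by (rule grel.gtrans)
qed (simp add: grel.grefl)

lemma group_GX: "group GX"
proof (rule groupI)
  fix c assume "c \<in> carrier GX"
  then obtain w where w: "w \<in> wordX X" "c = cls w"
    by (auto simp: carrier_GX)
  have v: "map (\<lambda>(x, b). (x, \<not> b)) (rev w) \<in> wordX X"
    using w by (auto simp: wordX_def)
  then have "cls (map (\<lambda>(x, b). (x, \<not> b)) (rev w)) \<otimes>\<^bsub>GX\<^esub> c = \<one>\<^bsub>GX\<^esub>"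
    using w grel_inverse[OF w(1)] gclass_eq_iff by (simp add: mult_cls one_GX)
  then show "\<exists>d\<in>carrier GX. d \<otimes>\<^bsub>GX\<^esub> c = \<one>\<^bsub>GX\<^esub>"
    using v cls_closed by blast
qed (auto simp: carrier_GX mult_cls one_GX)

sublocale GX: group GX
  by (rule group_GX)

abbreviation "g \<equiv> gen X r"

lemma gen_closed [simp]: "x \<in> X \<Longrightarrow> g x \<in> carrier GX"
  by (simp add: gen_def)

lemma inv_gen: "x \<in> X \<Longrightarrow> inv\<^bsub>GX\<^esub> (g x) = cls [(x, False)]"
  using grel.gcancel[of "[]" X "[]" x r False] gclass_eq_iff
  by (intro GX.inv_equality) (auto simp: gen_def mult_cls one_GX)

lemma gen_relation: "x \<in> X \<Longrightarrow> y \<in> X \<Longrightarrow> g x \<otimes>\<^bsub>GX\<^esub> g y = g (lt x y) \<otimes>\<^bsub>GX\<^esub> g (rt x y)"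
  using grel.grelation[of "[]" X "[]" x y r] gclass_eq_iff by (simp add: gen_def mult_cls)

lemma GX_induct [consumes 1, case_names one gen inv_gen]:
  assumes "c \<in> carrier GX" "Q \<one>\<^bsub>GX\<^esub>"
    and "\<And>x c. x \<in> X \<Longrightarrow> c \<in> carrier GX \<Longrightarrow> Q c \<Longrightarrow> Q (g x \<otimes>\<^bsub>GX\<^esub> c)"
    and "\<And>x c. x \<in> X \<Longrightarrow> c \<in> carrier GX \<Longrightarrow> Q c \<Longrightarrow> Q (inv\<^bsub>GX\<^esub> (g x) \<otimes>\<^bsub>GX\<^esub> c)"
  shows "Q c"
proof -
  have "Q (cls w)" if "w \<in> wordX X" for w
    using that
  proof (induction w)
    case Nil
    show ?case using assms(2) one_GX by simp
  next
    case (Cons l w)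
    obtain x b where [simp]: "l = (x, b)" by fastforce
    have "cls (l # w) = (if b then g x else inv\<^bsub>GX\<^esub> (g x)) \<otimes>\<^bsub>GX\<^esub> cls w"
      using Cons.prems by (simp add: inv_gen mult_cls) (simp add: gen_def mult_cls)
    then show ?case
      using Cons assms(3,4)[of x "cls w"] by (cases b) simp_all
  qed
  then show ?thesis
    using assms(1) by (auto simp: carrier_GX)
qed

text \<open>Left induction is applied to the inverse, which exchanges left and right factors and the
  two kinds of letters. The additive translations multiply on the right and call for this
  form.\<close>

lemma GX_induct_right [consumes 1, case_names one gen inv_gen]:
  assumes "c \<in> carrier GX" "Q \<one>\<^bsub>GX\<^esub>"
    and "\<And>x c. x \<in> X \<Longrightarrow> c \<in> carrier GX \<Longrightarrow> Q c \<Longrightarrow> Q (c \<otimes>\<^bsub>GX\<^esub> g x)"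
    and "\<And>x c. x \<in> X \<Longrightarrow> c \<in> carrier GX \<Longrightarrow> Q c \<Longrightarrow> Q (c \<otimes>\<^bsub>GX\<^esub> inv\<^bsub>GX\<^esub> (g x))"
  shows "Q c"
proof -
  have "Q (inv\<^bsub>GX\<^esub> d)" if "d \<in> carrier GX" for d
    using that
  proof (induction rule: GX_induct)
    case one
    then show ?case using assms(2) by simp
  next
    case (gen x c)
    then show ?case using assms(4)[of x "inv\<^bsub>GX\<^esub> c"] by (simp add: GX.inv_mult_group)
  next
    case (inv_gen x c)
    then show ?case using assms(3)[of x "inv\<^bsub>GX\<^esub> c"] by (simp add: GX.inv_mult_group)
  qed
  from this[of "inv\<^bsub>GX\<^esub> c"] show ?thesis
    using assms(1) by simp
qed

section \<open>The homomorphism to permutations and the cocycle on classes\<close>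

abbreviation "LX \<equiv> LG X r"

definition class_coc :: "'a word set \<Rightarrow> 'a \<Rightarrow> int" where
  "class_coc c = word_coc (SOME w. w \<in> c)"

lemma LG_cls: "w \<in> wordX X \<Longrightarrow> LX (cls w) = L w"
  using grel_L[OF grel_rep] by (simp add: LG_def)

lemma class_coc_cls: "w \<in> wordX X \<Longrightarrow> class_coc (cls w) = word_coc w"
  using grel_word_coc[OF grel_rep] by (simp add: class_coc_def)

lemma LG_mult: "c \<in> carrier GX \<Longrightarrow> d \<in> carrier GX \<Longrightarrow> LX (c \<otimes>\<^bsub>GX\<^esub> d) = LX c \<circ> LX d"
  by (auto simp: carrier_GX mult_cls LG_cls L_append)

lemma LG_one: "LX \<one>\<^bsub>GX\<^esub> = id"
  by (simp add: one_GX LG_cls)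

lemma LG_gen: "x \<in> X \<Longrightarrow> LX (g x) = Lgen X r x"
  by (simp add: gen_def LG_cls)

lemma LG_permutes: "c \<in> carrier GX \<Longrightarrow> LX c permutes X"
  by (auto simp: carrier_GX LG_cls L_permutes)

lemma LG_bij: "c \<in> carrier GX \<Longrightarrow> bij (LX c)"
  by (rule permutes_bij[OF LG_permutes])

lemma LG_closed: "c \<in> carrier GX \<Longrightarrow> x \<in> X \<Longrightarrow> LX c x \<in> X"
  by (simp add: permutes_in_image[OF LG_permutes])

lemma LG_inv_left: "c \<in> carrier GX \<Longrightarrow> LX (inv\<^bsub>GX\<^esub> c) (LX c x) = x"
  using LG_mult[of "inv\<^bsub>GX\<^esub> c" c] LG_one by (simp add: fun_eq_iff)

lemma LG_inv_right: "c \<in> carrier GX \<Longrightarrow> LX c (LX (inv\<^bsub>GX\<^esub> c) x) = x"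
  using LG_mult[of c "inv\<^bsub>GX\<^esub> c"] LG_one by (simp add: fun_eq_iff)

lemma LG_gen_apply: "x \<in> X \<Longrightarrow> y \<in> X \<Longrightarrow> LX (g x) y = lt x y"
  by (simp add: LG_gen Lgen_def)

lemma class_coc_mult:
  "c \<in> carrier GX \<Longrightarrow> d \<in> carrier GX \<Longrightarrow>
    class_coc (c \<otimes>\<^bsub>GX\<^esub> d) = class_coc c + perm_act (LX c) (class_coc d)"
  by (auto simp: carrier_GX mult_cls LG_cls class_coc_cls word_coc_append)

lemma class_coc_one: "class_coc \<one>\<^bsub>GX\<^esub> = 0"
  by (simp add: one_GX class_coc_cls)

lemma class_coc_gen: "x \<in> X \<Longrightarrow> class_coc (g x) = basis_vec x"
  by (simp add: gen_def class_coc_cls)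

text \<open>\<open>add_gen y\<close> and \<open>sub_gen y\<close> translate by \<open>\<plusminus>y\<close> in the additive group of the brace \<open>G\<close>.\<close>

definition add_gen :: "'a \<Rightarrow> 'a word set \<Rightarrow> 'a word set" where
  "add_gen y c = c \<otimes>\<^bsub>GX\<^esub> g (LX (inv\<^bsub>GX\<^esub> c) y)"

text \<open>The inverse of the bijection x |-> L_x^(-1) x. The cocycle value of the inverse of
  \<open>g x\<close> is minus the basis vector of L_x^(-1) x, so subtracting u means multiplying by
  the inverse of \<open>g x\<close> for the x with L_x^(-1) x = u.\<close>

definition diagonal_inv :: "'a \<Rightarrow> 'a" where
  "diagonal_inv y = (THE x. x \<in> X \<and> lt x y = x)"

definition sub_gen :: "'a \<Rightarrow> 'a word set \<Rightarrow> 'a word set" where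
  "sub_gen y c = c \<otimes>\<^bsub>GX\<^esub> inv\<^bsub>GX\<^esub> (g (diagonal_inv (LX (inv\<^bsub>GX\<^esub> c) y)))"

lemma diagonal_inv:
  assumes "y \<in> X"
  shows "diagonal_inv y \<in> X" "lt (diagonal_inv y) y = diagonal_inv y"
  using theI'[OF diagonal_bijective[OF assms]] by (simp_all add: diagonal_inv_def)

lemma diagonal_inv_eq: "x \<in> X \<Longrightarrow> y \<in> X \<Longrightarrow> lt x y = x \<Longrightarrow> diagonal_inv y = x"
  unfolding diagonal_inv_def using diagonal_bijective[of y] by (simp add: the1_equality)

lemma add_gen_closed [simp]: "y \<in> X \<Longrightarrow> c \<in> carrier GX \<Longrightarrow> add_gen y c \<in> carrier GX"
  by (simp add: add_gen_def LG_closed)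

lemma sub_gen_closed [simp]: "y \<in> X \<Longrightarrow> c \<in> carrier GX \<Longrightarrow> sub_gen y c \<in> carrier GX"
  by (simp add: sub_gen_def LG_closed diagonal_inv)

lemma add_gen_sub_gen:
  assumes "y \<in> X" "c \<in> carrier GX"
  shows "add_gen y (sub_gen y c) = c"
proof -
  define u where "u = LX (inv\<^bsub>GX\<^esub> c) y"
  define x where "x = diagonal_inv u"
  have u: "u \<in> X" and x: "x \<in> X" "lt x u = x"
    using assms diagonal_inv[of u] by (simp_all add: u_def x_def LG_closed)
  have "LX (inv\<^bsub>GX\<^esub> (c \<otimes>\<^bsub>GX\<^esub> inv\<^bsub>GX\<^esub> (g x))) y = x"
    using assms u x by (simp add: GX.inv_mult_group LG_mult LG_gen_apply u_def[symmetric])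
  then show ?thesis
    using assms x by (simp add: sub_gen_def add_gen_def u_def[symmetric] x_def[symmetric] GX.m_assoc)
qed

lemma sub_gen_add_gen:
  assumes "y \<in> X" "c \<in> carrier GX"
  shows "sub_gen y (add_gen y c) = c"
proof -
  define u where "u = LX (inv\<^bsub>GX\<^esub> c) y"
  define v where "v = LX (inv\<^bsub>GX\<^esub> (g u)) u"
  have u: "u \<in> X" and v: "v \<in> X"
    using assms by (simp_all add: u_def v_def LG_closed)
  have "lt u v = u"
    using LG_inv_right[of "g u" u] u LG_gen_apply[OF u v] by (simp add: v_def)
  then have "diagonal_inv v = u"
    using u v by (intro diagonal_inv_eq)
  moreover have "LX (inv\<^bsub>GX\<^esub> (c \<otimes>\<^bsub>GX\<^esub> g u)) y = v"
    using assms u by (simp add: GX.inv_mult_group LG_mult u_def[symmetric] v_def)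
  ultimately show ?thesis
    using assms u by (simp add: sub_gen_def add_gen_def u_def[symmetric] GX.m_assoc)
qed

text \<open>Translating twice multiplies by \<open>g u\<close> and \<open>g v'\<close> in one order
  and by \<open>g v\<close> and \<open>g u'\<close> in the other. These products are the two sides
  of a defining relation, because r maps \<open>(u, v')\<close> to \<open>(v, u')\<close>.\<close>

lemma add_gen_commute:
  assumes "y \<in> X" "z \<in> X" "c \<in> carrier GX"
  shows "add_gen y (add_gen z c) = add_gen z (add_gen y c)"
proof -
  define u v where "u = LX (inv\<^bsub>GX\<^esub> c) y" and "v = LX (inv\<^bsub>GX\<^esub> c) z"
  define u' v' where "u' = LX (inv\<^bsub>GX\<^esub> (g v)) u" and "v' = LX (inv\<^bsub>GX\<^esub> (g u)) v"
  have X: "u \<in> X" "v \<in> X" "u' \<in> X" "v' \<in> X"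
    using assms by (simp_all add: u_def v_def u'_def v'_def LG_closed)
  have v: "lt u v' = v"
    using LG_inv_right[of "g u" v] LG_gen_apply[of u v'] X by (simp add: v'_def)
  have u: "lt v u' = u"
    using LG_inv_right[of "g v" u] LG_gen_apply[of v u'] X by (simp add: u'_def)
  \<comment> \<open>Involutivity, read off in the first coordinate; injectivity of
    \<open>lt v\<close> then identifies \<open>rt u v'\<close>.\<close>
  have "lt v (rt u v') = u"
    using r_r[of u v'] X v by simp
  then have "rt u v' = u'"
    using u X lt_inj[of v "rt u v'" u'] by simp
  then have "g u \<otimes>\<^bsub>GX\<^esub> g v' = g v \<otimes>\<^bsub>GX\<^esub> g u'"
    using gen_relation[of u v'] X v by simp
  moreover have "add_gen z (add_gen y c) = c \<otimes>\<^bsub>GX\<^esub> (g u \<otimes>\<^bsub>GX\<^esub> g v')"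
    using assms X by (simp add: add_gen_def GX.inv_mult_group LG_mult GX.m_assoc
        u_def[symmetric] v_def[symmetric] v'_def[symmetric])
  moreover have "add_gen y (add_gen z c) = c \<otimes>\<^bsub>GX\<^esub> (g v \<otimes>\<^bsub>GX\<^esub> g u')"
    using assms X by (simp add: add_gen_def GX.inv_mult_group LG_mult GX.m_assoc
        u_def[symmetric] v_def[symmetric] u'_def[symmetric])
  ultimately show ?thesis
    by simp
qed

text \<open>A map commuting with an invertible translation commutes with its inverse; the same
  argument gives the next lemma.\<close>

lemma sub_gen_add_gen_commute:
  assumes "y \<in> X" "z \<in> X" "c \<in> carrier GX"
  shows "sub_gen y (add_gen z c) = add_gen z (sub_gen y c)"
proof -
  have "sub_gen y (add_gen z c) = sub_gen y (add_gen z (add_gen y (sub_gen y c)))"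
    using assms by (simp add: add_gen_sub_gen)
  also have "\<dots> = sub_gen y (add_gen y (add_gen z (sub_gen y c)))"
    using assms add_gen_commute[of z y "sub_gen y c"] by simp
  finally show ?thesis
    using assms by (simp add: sub_gen_add_gen)
qed

lemma sub_gen_commute:
  assumes "y \<in> X" "z \<in> X" "c \<in> carrier GX"
  shows "sub_gen y (sub_gen z c) = sub_gen z (sub_gen y c)"
proof -
  have "sub_gen y (sub_gen z c) = sub_gen y (sub_gen z (add_gen y (sub_gen y c)))"
    using assms by (simp add: add_gen_sub_gen)
  also have "\<dots> = sub_gen y (add_gen y (sub_gen z (sub_gen y c)))"
    using assms sub_gen_add_gen_commute[of z y "sub_gen y c"] by simp
  finally show ?thesis
    using assms by (simp add: sub_gen_add_gen)
qed

text \<open>Right multiplication of \<open>c\<close> by \<open>g x\<close> is the translation by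
  \<open>LX c x\<close>, so induction over right multiplications becomes induction over
  translations.\<close>

lemma GX_induct_additive [consumes 1, case_names one add sub]:
  assumes "c \<in> carrier GX" "Q \<one>\<^bsub>GX\<^esub>"
    and add: "\<And>y c. y \<in> X \<Longrightarrow> c \<in> carrier GX \<Longrightarrow> Q c \<Longrightarrow> Q (add_gen y c)"
    and sub: "\<And>y c. y \<in> X \<Longrightarrow> c \<in> carrier GX \<Longrightarrow> Q c \<Longrightarrow> Q (sub_gen y c)"
  shows "Q c"
  using assms(1)
proof (induction rule: GX_induct_right)
  case one
  show ?case by fact
next
  case (gen x c)
  then show ?case
    using add[of "LX c x" c] by (simp add: add_gen_def LG_closed LG_inv_left)
next
  case (inv_gen x c)
  \<comment> \<open>The translation by \<open>LX d x\<close> leads from \<open>d\<close> to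
    \<open>c\<close>, so passing from \<open>c\<close> to \<open>d\<close> is the inverse
    translation.\<close>
  define d where "d = c \<otimes>\<^bsub>GX\<^esub> inv\<^bsub>GX\<^esub> (g x)"
  have d: "d \<in> carrier GX" "LX d x \<in> X" "add_gen (LX d x) d = c"
    using inv_gen by (simp_all add: d_def add_gen_def LG_closed LG_inv_left GX.m_assoc)
  then have "sub_gen (LX d x) c = d"
    using sub_gen_add_gen by metis
  then show ?case
    using sub[OF d(2) inv_gen(2,3)] by (simp add: d_def)
qed

lemma class_coc_add_gen: "y \<in> X \<Longrightarrow> c \<in> carrier GX \<Longrightarrow> class_coc (add_gen y c) = class_coc c + basis_vec y"
  by (simp add: add_gen_def class_coc_mult LG_closed class_coc_gen perm_act_basis_vec LG_bij LG_inv_right)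

lemma class_coc_sub_gen: "y \<in> X \<Longrightarrow> c \<in> carrier GX \<Longrightarrow> class_coc (sub_gen y c) = class_coc c - basis_vec y"
  using class_coc_add_gen[of y "sub_gen y c"] by (simp add: add_gen_sub_gen algebra_simps)

text \<open>Words are reused as formal sums: a letter now adds or subtracts its generator in the
  additive group instead of multiplying by it.\<close>

primrec letter_shift :: "'a \<times> bool \<Rightarrow> 'a word set \<Rightarrow> 'a word set" where
  "letter_shift (y, b) = (if b then add_gen y else sub_gen y)"

primrec shift :: "'a word \<Rightarrow> 'a word set \<Rightarrow> 'a word set" where
  "shift [] c = c"
| "shift (l # u) c = letter_shift l (shift u c)"

primrec signed_sum :: "'a word \<Rightarrow> 'a \<Rightarrow> int" where
  "signed_sum [] z = 0"
| "signed_sum (l # u) z = (if z = fst l then if snd l then 1 else -1 else 0) + signed_sum u z"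

lemma letter_shift_closed [simp]: "fst l \<in> X \<Longrightarrow> c \<in> carrier GX \<Longrightarrow> letter_shift l c \<in> carrier GX"
  by (cases l) simp

lemma shift_closed [simp]: "u \<in> wordX X \<Longrightarrow> c \<in> carrier GX \<Longrightarrow> shift u c \<in> carrier GX"
  by (induction u) simp_all

lemma letter_shift_commute:
  "fst l \<in> X \<Longrightarrow> fst k \<in> X \<Longrightarrow> c \<in> carrier GX \<Longrightarrow>
    letter_shift l (letter_shift k c) = letter_shift k (letter_shift l c)"
  using add_gen_commute[of "fst l" "fst k" c] sub_gen_commute[of "fst l" "fst k" c]
    sub_gen_add_gen_commute[of "fst l" "fst k" c] sub_gen_add_gen_commute[of "fst k" "fst l" c]
  by (cases l; cases k) simp

lemma shift_middle:
  "u \<in> wordX X \<Longrightarrow> v \<in> wordX X \<Longrightarrow> fst l \<in> X \<Longrightarrow> c \<in> carrier GX \<Longrightarrow>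
    shift (u @ l # v) c = letter_shift l (shift (u @ v) c)"
  by (induction u) (simp_all add: letter_shift_commute[of l])

lemma signed_sum_append: "signed_sum (u @ v) z = signed_sum u z + signed_sum v z"
  by (induction u) simp_all

lemma signed_sum_nonneg: "(z, False) \<notin> set u \<Longrightarrow> 0 \<le> signed_sum u z"
  by (induction u) auto

lemma signed_sum_nonpos: "(z, True) \<notin> set u \<Longrightarrow> signed_sum u z \<le> 0"
  by (induction u) auto

lemma class_coc_shift:
  "u \<in> wordX X \<Longrightarrow> c \<in> carrier GX \<Longrightarrow> class_coc (shift u c) z = class_coc c z + signed_sum u z"
proof (induction u)
  case (Cons l u)
  then show ?case
    by (cases l) (auto simp: class_coc_add_gen class_coc_sub_gen basis_vec_def)
qed simp

text \<open>For the counts to vanish, the first letter needs an opposite one later in the word.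
  Commutativity moves that letter next to it, the pair cancels, and the shorter word still has all
  counts zero.\<close>

lemma shift_eq_self:
  "u \<in> wordX X \<Longrightarrow> c \<in> carrier GX \<Longrightarrow> (\<And>z. signed_sum u z = 0) \<Longrightarrow> shift u c = c"
proof (induction u rule: length_induct)
  case (1 u)
  show ?case
  proof (cases u)
    case (Cons l w)
    obtain y b where l: "l = (y, b)" by fastforce
    have "signed_sum w y = (if b then -1 else 1)"
      using 1(4)[of y] by (cases b) (simp_all add: Cons l)
    then have "(y, \<not> b) \<in> set w"
      using signed_sum_nonneg[of y w] signed_sum_nonpos[of y w] by (cases b) force+
    then obtain p q where w: "w = p @ (y, \<not> b) # q"
      using split_list by metis
    have X: "y \<in> X" "p \<in> wordX X" "q \<in> wordX X"
      using 1(2) by (simp_all add: Cons l w)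
    have "signed_sum (p @ q) z = 0" for z
      using 1(4)[of z] by (cases b) (auto simp: Cons l w signed_sum_append split: if_splits)
    then have "shift (p @ q) c = c"
      using 1(1,3) X by (simp add: Cons w)
    then have "shift u c = letter_shift (y, b) (letter_shift (y, \<not> b) c)"
      using X 1(3) by (simp add: Cons l w shift_middle del: letter_shift.simps)
    also have "\<dots> = c"
      using X 1(3) by (cases b) (simp_all add: sub_gen_add_gen add_gen_sub_gen)
    finally show ?thesis .
  qed simp
qed

lemma ex_shift:
  assumes "c \<in> carrier GX"
  shows "\<exists>u\<in>wordX X. c = shift u \<one>\<^bsub>GX\<^esub>"
  using assms
proof (induction rule: GX_induct_additive)
  case one
  show ?case by (rule bexI[of _ "[]"]) simp_all
next
  case (add y c)
  then obtain u where "u \<in> wordX X" "c = shift u \<one>\<^bsub>GX\<^esub>" by blast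
  then show ?case
    using add by (intro bexI[of _ "(y, True) # u"]) simp_all
next
  case (sub y c)
  then obtain u where "u \<in> wordX X" "c = shift u \<one>\<^bsub>GX\<^esub>" by blast
  then show ?case
    using sub by (intro bexI[of _ "(y, False) # u"]) simp_all
qed

text \<open>A word of translations leads from 1 to \<open>c\<close>, and its signed counts are the
  cocycle values of \<open>c\<close>; when they vanish, the word leaves 1 where it is.\<close>

lemma class_coc_eq_zeroD:
  assumes "c \<in> carrier GX" "class_coc c = 0"
  shows "c = \<one>\<^bsub>GX\<^esub>"
proof -
  obtain u where u: "u \<in> wordX X" "c = shift u \<one>\<^bsub>GX\<^esub>"
    using ex_shift assms by blast
  then have "signed_sum u z = 0" for z
    using class_coc_shift[OF u(1) GX.one_closed, of z] assms(2) class_coc_one by simp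
  then show ?thesis
    using u shift_eq_self[of u "\<one>\<^bsub>GX\<^esub>"] by simp
qed

text \<open>A cocycle is not a homomorphism, but its value at c^(-1) d depends on d only through the
  value at d; it therefore equals the value at c^(-1) c, which is 0.\<close>

lemma inj_class_coc: "inj_on class_coc (carrier GX)"
proof (rule inj_onI)
  fix c d assume cd: "c \<in> carrier GX" "d \<in> carrier GX" "class_coc c = class_coc d"
  have "class_coc (inv\<^bsub>GX\<^esub> c \<otimes>\<^bsub>GX\<^esub> d) = class_coc (inv\<^bsub>GX\<^esub> c \<otimes>\<^bsub>GX\<^esub> c)"
    using cd class_coc_mult[of "inv\<^bsub>GX\<^esub> c" d] class_coc_mult[of "inv\<^bsub>GX\<^esub> c" c] by simp
  then have "inv\<^bsub>GX\<^esub> c \<otimes>\<^bsub>GX\<^esub> d = \<one>\<^bsub>GX\<^esub>"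
    using cd by (intro class_coc_eq_zeroD) (simp_all add: class_coc_one)
  then show "c = d"
    using cd GX.inv_solve_left'[of d c "\<one>\<^bsub>GX\<^esub>"] by (metis GX.inv_equality GX.inv_closed GX.inv_inv)
qed

sublocale GC: generated_cocycle GX "\<lambda>c. perm_act (LX c)" class_coc X g lt
proof
  fix a b u v assume a: "a \<in> carrier GX"
  show "perm_act (LX a) (u + v) = perm_act (LX a) u + perm_act (LX a) v"
    by (rule perm_act_add)
  assume b: "b \<in> carrier GX"
  show "perm_act (LX (a \<otimes>\<^bsub>GX\<^esub> b)) u = perm_act (LX a) (perm_act (LX b) u)"
    using a b by (simp add: LG_mult perm_act_comp LG_bij)
  show "class_coc (a \<otimes>\<^bsub>GX\<^esub> b) = class_coc a + perm_act (LX a) (class_coc b)"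
    using a b by (rule class_coc_mult)
  \<comment> \<open>Moving by \<open>LX a\<close> turns the translation by y into the one by
    \<open>LX a y\<close>, so an element with the moved value is rebuilt one translation at a
    time.\<close>
  show "perm_act (LX a) (class_coc b) \<in> class_coc ` carrier GX"
    using b
  proof (induction rule: GX_induct_additive)
    case one
    show ?case
      using class_coc_one by (metis GX.one_closed imageI perm_act_zero)
  next
    case (add y c)
    then obtain d where d: "d \<in> carrier GX" "perm_act (LX a) (class_coc c) = class_coc d" by blast
    have "perm_act (LX a) (class_coc (add_gen y c)) = class_coc (add_gen (LX a y) d)"
      using a add d by (simp add: class_coc_add_gen LG_closed perm_act_add perm_act_basis_vec LG_bij)
    then show ?case
      using d a add LG_closed by simp
  next
    case (sub y c)
    then obtain d where d: "d \<in> carrier GX" "perm_act (LX a) (class_coc c) = class_coc d" by blast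
    have "perm_act (LX a) (class_coc (sub_gen y c))
        = perm_act (LX a) (class_coc c) + - perm_act (LX a) (basis_vec y)"
      using a sub by (simp only: class_coc_sub_gen perm_act_add perm_act_uminus diff_conv_add_uminus)
    then have "perm_act (LX a) (class_coc (sub_gen y c)) = class_coc (sub_gen (LX a y) d)"
      using a sub d by (simp add: class_coc_sub_gen LG_closed perm_act_basis_vec LG_bij)
    then show ?case
      using d a sub LG_closed by simp
  qed
next
  show "perm_act (LX \<one>\<^bsub>GX\<^esub>) u = u" for u
    by (simp add: LG_one)
  show "inj_on class_coc (carrier GX)"
    by (rule inj_class_coc)
  show "g x \<in> carrier GX" if "x \<in> X" for x
    using that by simp
  show "lt x y \<in> X" if "x \<in> X" "y \<in> X" for x y
    using that by simp
  show "perm_act (LX (g x)) (class_coc (g y)) = class_coc (g (lt x y))" if "x \<in> X" "y \<in> X" for x y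
    using that by (simp add: class_coc_gen perm_act_basis_vec LG_bij LG_gen_apply)
  show "inj_on (\<lambda>x. class_coc (g x)) X"
    by (rule inj_onI) (simp add: class_coc_gen)
  show "\<exists>y\<in>X. perm_act (LX a) (class_coc (g x)) = class_coc (g y)"
    if "a \<in> carrier GX" "x \<in> X" for a x
    using that LG_closed by (intro bexI[of _ "LX a x"]) (simp_all add: class_coc_gen perm_act_basis_vec LG_bij)
next
  fix Q :: "('a \<Rightarrow> int) set"
  assume Q: "0 \<in> Q" "\<And>u v. u \<in> Q \<Longrightarrow> v \<in> Q \<Longrightarrow> u + v \<in> Q" "\<And>u. u \<in> Q \<Longrightarrow> - u \<in> Q"
    "\<And>x. x \<in> X \<Longrightarrow> class_coc (g x) \<in> Q"
  have "class_coc c \<in> Q" if "c \<in> carrier GX" for c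
    using that
  proof (induction rule: GX_induct_additive)
    case one
    show ?case unfolding class_coc_one by (rule Q(1))
  next
    case (add y c)
    then show ?case
      unfolding class_coc_add_gen[OF add(1,2)] class_coc_gen[OF add(1), symmetric] by (intro Q(2,4))
  next
    case (sub y c)
    then show ?case
      unfolding class_coc_sub_gen[OF sub(1,2)] class_coc_gen[OF sub(1), symmetric] diff_conv_add_uminus
      by (intro Q(2,3,4))
  qed
  then show "class_coc ` carrier GX \<subseteq> Q"
    by blast
qed

end

section \<open>Uniqueness of the braiding that extends r\<close>

lemma symgroupD:
  assumes "symgroup G \<sigma>" "a \<in> carrier G" "b \<in> carrier G" "u \<in> carrier G" "v \<in> carrier G"
  shows "fst (\<sigma> (a, \<one>\<^bsub>G\<^esub>)) = \<one>\<^bsub>G\<^esub>" "fst (\<sigma> (\<one>\<^bsub>G\<^esub>, u)) = u" "snd (\<sigma> (a, \<one>\<^bsub>G\<^esub>)) = a"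
    and "fst (\<sigma> (a \<otimes>\<^bsub>G\<^esub> b, u)) = fst (\<sigma> (a, fst (\<sigma> (b, u))))"
    and "snd (\<sigma> (a, u \<otimes>\<^bsub>G\<^esub> v)) = snd (\<sigma> (snd (\<sigma> (a, u)), v))"
    and "fst (\<sigma> (a, u \<otimes>\<^bsub>G\<^esub> v)) = fst (\<sigma> (a, u)) \<otimes>\<^bsub>G\<^esub> fst (\<sigma> (snd (\<sigma> (a, u)), v))"
    and "u \<otimes>\<^bsub>G\<^esub> v = fst (\<sigma> (u, v)) \<otimes>\<^bsub>G\<^esub> snd (\<sigma> (u, v))"
  using assms(1)[unfolded symgroup_def Let_def, THEN conjunct2, THEN conjunct2, THEN conjunct2,
      THEN bspec, THEN bspec, THEN bspec, THEN bspec, OF assms(2-5)]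
  by blast+

lemma symgroup_closed:
  assumes "symgroup G \<sigma>" "a \<in> carrier G" "b \<in> carrier G"
  shows "fst (\<sigma> (a, b)) \<in> carrier G" "snd (\<sigma> (a, b)) \<in> carrier G"
proof -
  have "\<sigma> (a, b) \<in> carrier G \<times> carrier G"
    using assms unfolding symgroup_def by (meson SigmaI bij_betwE)
  then show "fst (\<sigma> (a, b)) \<in> carrier G" "snd (\<sigma> (a, b)) \<in> carrier G"
    by (simp_all add: mem_Times_iff)
qed

context symmetric_set
begin

definition extends_r :: "('a word set \<times> 'a word set \<Rightarrow> 'a word set \<times> 'a word set) \<Rightarrow> bool" where
  "extends_r \<sigma> \<longleftrightarrow> symgroup GX \<sigma> \<and> (\<forall>x\<in>X. \<forall>y\<in>X. \<sigma> (g x, g y) = (g (lt x y), g (rt x y)))"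

text \<open>Acting on x' from the right by y and then by its inverse gives back x', while x' acting
  from the left fixes y y^(-1) = 1. Expanding these two facts yields the two components.\<close>

lemma extends_r_inv_gen:
  assumes \<sigma>: "extends_r \<sigma>" and X: "x \<in> X" "y \<in> X" "x' \<in> X" "rt x' y = x"
  shows "\<sigma> (g x, inv\<^bsub>GX\<^esub> (g y)) = (inv\<^bsub>GX\<^esub> (g (lt x' y)), g x')"
proof -
  have s: "symgroup GX \<sigma>" and e: "\<sigma> (g x', g y) = (g (lt x' y), g x)"
    using \<sigma> X by (simp_all add: extends_r_def)
  have cl: "g x \<in> carrier GX" "g x' \<in> carrier GX" "g y \<in> carrier GX" "inv\<^bsub>GX\<^esub> (g y) \<in> carrier GX"
    using X by simp_all
  have "snd (\<sigma> (g x, inv\<^bsub>GX\<^esub> (g y))) = snd (\<sigma> (g x', g y \<otimes>\<^bsub>GX\<^esub> inv\<^bsub>GX\<^esub> (g y)))"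
    using symgroupD(5)[OF s cl(2,2,3,4)] e by simp
  also have "\<dots> = g x'"
    using symgroupD(3)[OF s cl(2,2,3,4)] cl by simp
  finally have 1: "snd (\<sigma> (g x, inv\<^bsub>GX\<^esub> (g y))) = g x'" .
  have "g (lt x' y) \<otimes>\<^bsub>GX\<^esub> fst (\<sigma> (g x, inv\<^bsub>GX\<^esub> (g y))) = fst (\<sigma> (g x', g y \<otimes>\<^bsub>GX\<^esub> inv\<^bsub>GX\<^esub> (g y)))"
    using symgroupD(6)[OF s cl(2,2,3,4)] e by simp
  also have "\<dots> = \<one>\<^bsub>GX\<^esub>"
    using symgroupD(1)[OF s cl(2,2,3,4)] cl by simp
  finally have "fst (\<sigma> (g x, inv\<^bsub>GX\<^esub> (g y))) = inv\<^bsub>GX\<^esub> (g (lt x' y))"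
    using GX.inv_comm GX.inv_equality symgroup_closed(1)[OF s cl(1,4)] X by (metis gen_closed lt_closed)
  with 1 show ?thesis
    by (simp add: prod_eq_iff)
qed

text \<open>Splitting a letter off \<open>c\<close> leaves a generator as the acting element, that
  of \<open>rt x y\<close> or, for an inverse letter, that of the x' in
  \<open>extends_r_inv_gen\<close>. Hence an induction on \<open>c\<close> with \<open>x\<close>
  generalised stays within actions of generators.\<close>

lemma extends_r_gen_unique:
  assumes "extends_r \<sigma>" "extends_r \<tau>" "x \<in> X" "c \<in> carrier GX"
  shows "fst (\<sigma> (g x, c)) = fst (\<tau> (g x, c))"
  using assms(4,3)
proof (induction arbitrary: x rule: GX_induct)
  case one
  have "fst (\<rho> (g x, \<one>\<^bsub>GX\<^esub>)) = \<one>\<^bsub>GX\<^esub>" if "extends_r \<rho>" for \<rho>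
    using that one symgroupD(1)[of GX \<rho> "g x" "g x" "g x" "g x"] by (simp add: extends_r_def)
  then show ?case
    using assms(1,2) by simp
next
  case (gen y c)
  have "fst (\<rho> (g x, g y \<otimes>\<^bsub>GX\<^esub> c)) = g (lt x y) \<otimes>\<^bsub>GX\<^esub> fst (\<rho> (g (rt x y), c))" if "extends_r \<rho>" for \<rho>
    using that gen symgroupD(6)[of GX \<rho> "g x" "g x" "g y" c] by (simp add: extends_r_def)
  then show ?case
    using assms(1,2) gen by simp
next
  case (inv_gen y c)
  obtain x' where x': "x' \<in> X" "rt x' y = x"
    using rt_surj[OF inv_gen(1,4)] by blast
  have "fst (\<rho> (g x, inv\<^bsub>GX\<^esub> (g y) \<otimes>\<^bsub>GX\<^esub> c)) = inv\<^bsub>GX\<^esub> (g (lt x' y)) \<otimes>\<^bsub>GX\<^esub> fst (\<rho> (g x', c))"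
    if "extends_r \<rho>" for \<rho>
    using that inv_gen symgroupD(6)[of GX \<rho> "g x" "g x" "inv\<^bsub>GX\<^esub> (g y)" c]
      extends_r_inv_gen[OF that inv_gen(4,1) x'] by (simp add: extends_r_def)
  then show ?case
    using assms(1,2) inv_gen x' by simp
qed

lemma extends_r_fst_unique:
  assumes \<sigma>: "extends_r \<sigma>" and \<tau>: "extends_r \<tau>" and "a \<in> carrier GX" "c \<in> carrier GX"
  shows "fst (\<sigma> (a, c)) = fst (\<tau> (a, c))"
  using assms(3,4)
proof (induction arbitrary: c rule: GX_induct)
  case one
  have "fst (\<rho> (\<one>\<^bsub>GX\<^esub>, c)) = c" if "extends_r \<rho>" for \<rho>
    using that one symgroupD(2)[of GX \<rho> c c c c] by (simp add: extends_r_def)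
  then show ?case
    using assms(1,2) by simp
next
  case (gen x a)
  have "fst (\<rho> (g x \<otimes>\<^bsub>GX\<^esub> a, c)) = fst (\<rho> (g x, fst (\<rho> (a, c))))" if "extends_r \<rho>" for \<rho>
    using that gen symgroupD(4)[of GX \<rho> "g x" a c c] by (simp add: extends_r_def)
  moreover have "fst (\<tau> (a, c)) \<in> carrier GX"
    using symgroup_closed(1)[of GX \<tau> a c] \<tau> gen by (simp add: extends_r_def)
  ultimately show ?case
    using extends_r_gen_unique[OF \<sigma> \<tau>] gen \<sigma> \<tau> by simp
next
  case (inv_gen x a)
  have s: "symgroup GX \<sigma>" "symgroup GX \<tau>"
    using \<sigma> \<tau> by (simp_all add: extends_r_def)
  have x: "g x \<in> carrier GX" "inv\<^bsub>GX\<^esub> (g x) \<in> carrier GX"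
    using inv_gen by simp_all
  \<comment> \<open>Acting on \<open>d\<close> by x gives the value at \<open>a\<close>, where both
    braidings agree by induction; acting by the inverse of x under \<tau> then recovers
    \<open>d\<close>.\<close>
  define d where "d = fst (\<sigma> (inv\<^bsub>GX\<^esub> (g x) \<otimes>\<^bsub>GX\<^esub> a, c))"
  have d: "d \<in> carrier GX"
    using symgroup_closed(1)[OF s(1)] x inv_gen by (simp add: d_def)
  have "fst (\<tau> (a, c)) = fst (\<sigma> (g x, d))"
    using symgroupD(4)[OF s(1) x(1) _ inv_gen(4,4), of "inv\<^bsub>GX\<^esub> (g x) \<otimes>\<^bsub>GX\<^esub> a"] x inv_gen
    by (simp add: d_def GX.m_assoc[symmetric])
  also have "\<dots> = fst (\<tau> (g x, d))"
    using extends_r_gen_unique[OF \<sigma> \<tau> inv_gen(1) d] .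
  finally have "fst (\<tau> (inv\<^bsub>GX\<^esub> (g x) \<otimes>\<^bsub>GX\<^esub> a, c)) = fst (\<tau> (inv\<^bsub>GX\<^esub> (g x), fst (\<tau> (g x, d))))"
    using symgroupD(4)[OF s(2) x(2) inv_gen(2,4,4)] by simp
  also have "\<dots> = d"
    using symgroupD(4)[OF s(2) x(2,1) d d] symgroupD(2)[OF s(2) d d d d] x by simp
  finally show ?case
    by (simp add: d_def)
qed

lemma extends_r_unique:
  assumes "extends_r \<sigma>" "extends_r \<tau>" "a \<in> carrier GX" "c \<in> carrier GX"
  shows "\<sigma> (a, c) = \<tau> (a, c)"
proof -
  have "snd (\<rho> (a, c)) = inv\<^bsub>GX\<^esub> (fst (\<rho> (a, c))) \<otimes>\<^bsub>GX\<^esub> (a \<otimes>\<^bsub>GX\<^esub> c)" if "extends_r \<rho>" for \<rho>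
  proof -
    have s: "symgroup GX \<rho>"
      using that by (simp add: extends_r_def)
    show ?thesis
      using symgroupD(7)[OF s assms(3,3,3,4)] symgroup_closed[OF s assms(3,4)]
      by (simp add: GX.m_assoc[symmetric])
  qed
  then show ?thesis
    using assms extends_r_fst_unique[OF assms] by (simp add: prod_eq_iff)
qed

lemma extends_r_braiding: "extends_r GC.braiding"
proof -
  have "GC.braiding (g x, g y) = (g (lt x y), g (rt x y))" if "x \<in> X" "y \<in> X" for x y
  proof -
    have l: "GC.lact (g x) (g y) = g (lt x y)"
      using that GC.coc_lact[of "g x" "g y"] GC.act_gen[of x y] by (intro GC.coc_eqD) simp_all
    have "GC.ract (g x) (g y) = g (rt x y)"
      using that gen_relation[of x y] by (simp add: GC.ract_def l GX.m_assoc[symmetric])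
    with l that show ?thesis
      by (simp add: GC.braiding_eq)
  qed
  then show ?thesis
    using GC.symgroup_braiding by (simp add: extends_r_def)
qed

lemma rG_eq_braiding: "rG X r = GC.braiding"
  unfolding rG_def
proof (rule the_equality)
  show "symgroup GX GC.braiding
    \<and> (\<forall>p. p \<notin> carrier GX \<times> carrier GX \<longrightarrow> GC.braiding p = p)
    \<and> (\<forall>x\<in>X. \<forall>y\<in>X. GC.braiding (g x, g y) = (g (lt x y), g (rt x y)))"
    using extends_r_braiding by (auto simp: extends_r_def GC.braiding_def)
next
  fix \<sigma> assume \<sigma>: "symgroup GX \<sigma> \<and> (\<forall>p. p \<notin> carrier GX \<times> carrier GX \<longrightarrow> \<sigma> p = p)
    \<and> (\<forall>x\<in>X. \<forall>y\<in>X. \<sigma> (g x, g y) = (g (lt x y), g (rt x y)))"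
  then have "extends_r \<sigma>"
    by (simp add: extends_r_def)
  show "\<sigma> = GC.braiding"
  proof
    fix p show "\<sigma> p = GC.braiding p"
      using \<sigma> extends_r_unique[OF \<open>extends_r \<sigma>\<close> extends_r_braiding]
      by (cases p; cases "p \<in> carrier GX \<times> carrier GX") (auto simp: GC.braiding_def)
  qed
qed

lemma fst_rG: "a \<in> carrier GX \<Longrightarrow> b \<in> carrier GX \<Longrightarrow> fst (rG X r (a, b)) = GC.lact a b"
  by (simp add: rG_eq_braiding GC.braiding_eq)

section \<open>Multipermutation levels\<close>

text \<open>The relation is membership of a difference in an ideal, and acting by x preserves this.
  The same reason serves for the group and for the permutation group.\<close>

lemma left_congruent_X: "left_congruent X r"
proof
  fix m x y y' assume X: "x \<in> X" "y \<in> X" "y' \<in> X" and "iter_ret_rel X lt m y y'"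
  then have "class_coc (g y) - class_coc (g y') \<in> GC.ideal_seq m"
    using GC.iter_ret_rel_generators by blast
  then have "perm_act (LX (g x)) (class_coc (g y) - class_coc (g y')) \<in> GC.ideal_seq m"
    using X by (intro GC.ideal_seq_act) simp_all
  then have "class_coc (g (lt x y)) - class_coc (g (lt x y')) \<in> GC.ideal_seq m"
    using X GC.act_diff[of "g x"] GC.act_gen[of x] by simp
  then show "iter_ret_rel X lt m (lt x y) (lt x y')"
    using X GC.iter_ret_rel_generators by simp
qed (use nonempty in simp_all)

lemma iter_ret_rel_GX:
  "a \<in> carrier GX \<Longrightarrow> b \<in> carrier GX \<Longrightarrow>
    iter_ret_rel (carrier GX) (\<lambda>a b. fst (rG X r (a, b))) m a b
      \<longleftrightarrow> class_coc a - class_coc b \<in> GC.ideal_seq m"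
  by (rule GC.iter_ret_rel_iff) (simp_all add: fst_rG)

lemma left_congruent_GX: "left_congruent (carrier GX) (rG X r)"
proof
  show "carrier GX \<noteq> {}"
    using GX.one_closed by blast
  fix m a b b' assume G: "a \<in> carrier GX" "b \<in> carrier GX" "b' \<in> carrier GX"
    and "iter_ret_rel (carrier GX) (\<lambda>a b. fst (rG X r (a, b))) m b b'"
  then have "perm_act (LX a) (class_coc b - class_coc b') \<in> GC.ideal_seq m"
    by (intro GC.ideal_seq_act) (simp_all add: iter_ret_rel_GX)
  then show "iter_ret_rel (carrier GX) (\<lambda>a b. fst (rG X r (a, b))) m
      (fst (rG X r (a, b))) (fst (rG X r (a, b')))"
    using G by (simp add: iter_ret_rel_GX fst_rG GC.coc_lact GC.act_diff)
qed (simp add: fst_rG)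

text \<open>The images of the basis vectors under the two actions agree iff the permutations agree
  on X, and off X both are the identity. This is the base of the shift by one level.\<close>

lemma LG_eq_iff:
  assumes "a \<in> carrier GX" "b \<in> carrier GX"
  shows "LX a = LX b \<longleftrightarrow> class_coc a - class_coc b \<in> GC.ideal_seq (Suc 0)"
proof -
  have "LX a = LX b \<longleftrightarrow> (\<forall>x\<in>X. LX a x = LX b x)"
    using LG_permutes assms by (metis ext permutes_not_in)
  also have "\<dots> \<longleftrightarrow> (\<forall>x\<in>X. perm_act (LX a) (class_coc (g x)) - perm_act (LX b) (class_coc (g x))
      \<in> GC.ideal_seq 0)"
    using assms by (simp add: class_coc_gen perm_act_basis_vec LG_bij)
  finally show ?thesis
    using GC.act_diff_on_generators[OF assms] GC.coc_diff_in_ideal_seq_Suc[OF assms] by blast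
qed

text \<open>Well-definedness: the chosen preimage of \<open>LX a\<close> acts as \<open>a\<close>
  does, and that of \<open>LX b\<close> differs from \<open>b\<close> by an element of the first
  ideal, which the action preserves.\<close>

lemma fst_r_perm:
  assumes "a \<in> carrier GX" "b \<in> carrier GX"
  shows "fst (r_perm X r (LX a, LX b)) = LX (GC.lact a b)"
proof -
  define a' b' where "a' = LG_pre X r (LX a)" and "b' = LG_pre X r (LX b)"
  have pre: "LG_pre X r (LX c) \<in> carrier GX \<and> LX (LG_pre X r (LX c)) = LX c" if "c \<in> carrier GX" for c
    unfolding LG_pre_def by (rule someI[of _ c]) (use that in simp)
  have a': "a' \<in> carrier GX" "LX a' = LX a" and b': "b' \<in> carrier GX" "LX b' = LX b"
    using pre assms by (simp_all add: a'_def b'_def)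
  have "class_coc b' - class_coc b \<in> GC.ideal_seq (Suc 0)"
    using LG_eq_iff b' assms by blast
  then have "perm_act (LX a) (class_coc b' - class_coc b) \<in> GC.ideal_seq (Suc 0)"
    using assms by (intro GC.ideal_seq_act)
  then have "class_coc (GC.lact a' b') - class_coc (GC.lact a b) \<in> GC.ideal_seq (Suc 0)"
    using assms a' b' by (simp add: GC.coc_lact GC.act_diff del: GC.ideal_seq.simps)
  then have "LX (GC.lact a' b') = LX (GC.lact a b)"
    using assms a' b' by (simp add: LG_eq_iff del: GC.ideal_seq.simps)
  then show ?thesis
    using a' b' by (simp add: r_perm_def Let_def a'_def[symmetric] b'_def[symmetric] fst_rG)
qed

lemma iter_ret_rel_Gperm:
  assumes "a \<in> carrier GX" "b \<in> carrier GX"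
  shows "iter_ret_rel (Gperm X r) (\<lambda>p q. fst (r_perm X r (p, q))) m (LX a) (LX b)
    \<longleftrightarrow> class_coc a - class_coc b \<in> GC.ideal_seq (Suc m)"
  using assms
proof (induction m arbitrary: a b)
  case 0
  then show ?case
    unfolding iter_ret_rel.simps by (rule LG_eq_iff)
next
  case (Suc m)
  have "iter_ret_rel (Gperm X r) (\<lambda>p q. fst (r_perm X r (p, q))) m
      (fst (r_perm X r (LX a, LX c))) (fst (r_perm X r (LX b, LX c)))
    \<longleftrightarrow> perm_act (LX a) (class_coc c) - perm_act (LX b) (class_coc c) \<in> GC.ideal_seq (Suc m)"
    if "c \<in> carrier GX" for c
    using Suc.IH[of "GC.lact a c" "GC.lact b c"] Suc.prems that by (simp only: fst_r_perm GC.coc_lact GC.lact_closed)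
  then show ?case
    unfolding GC.coc_diff_in_ideal_seq_Suc[OF Suc.prems] iter_ret_rel.simps
    unfolding Gperm_def by (simp only: ball_simps cong: ball_cong)
qed

lemma left_congruent_Gperm: "left_congruent (Gperm X r) (r_perm X r)"
proof
  show "Gperm X r \<noteq> {}"
    using GX.one_closed by (auto simp: Gperm_def)
  show "fst (r_perm X r (p, q)) \<in> Gperm X r" if "p \<in> Gperm X r" "q \<in> Gperm X r" for p q
    using that by (auto simp: Gperm_def fst_r_perm)
  fix m p q q' assume "p \<in> Gperm X r" "q \<in> Gperm X r" "q' \<in> Gperm X r"
    and rel: "iter_ret_rel (Gperm X r) (\<lambda>p q. fst (r_perm X r (p, q))) m q q'"
  then obtain a b b' where G: "a \<in> carrier GX" "b \<in> carrier GX" "b' \<in> carrier GX"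
    and pq: "p = LX a" "q = LX b" "q' = LX b'"
    by (auto simp: Gperm_def)
  have "perm_act (LX a) (class_coc b - class_coc b') \<in> GC.ideal_seq (Suc m)"
    using rel G unfolding pq by (intro GC.ideal_seq_act) (simp_all add: iter_ret_rel_Gperm del: GC.ideal_seq.simps)
  then show "iter_ret_rel (Gperm X r) (\<lambda>p q. fst (r_perm X r (p, q))) m
      (fst (r_perm X r (p, q))) (fst (r_perm X r (p, q')))"
    using G unfolding pq
    by (simp add: iter_ret_rel_Gperm fst_r_perm GC.coc_lact GC.act_diff del: GC.ideal_seq.simps)
qed

lemma full_iff:
  "(\<forall>a\<in>carrier GX. \<forall>b\<in>carrier GX. class_coc a - class_coc b \<in> GC.ideal_seq m)
    \<longleftrightarrow> class_coc ` carrier GX \<subseteq> GC.ideal_seq m"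
proof
  assume *: "\<forall>a\<in>carrier GX. \<forall>b\<in>carrier GX. class_coc a - class_coc b \<in> GC.ideal_seq m"
  show "class_coc ` carrier GX \<subseteq> GC.ideal_seq m"
  proof clarify
    fix a assume "a \<in> carrier GX"
    then show "class_coc a \<in> GC.ideal_seq m"
      using *[THEN bspec, THEN bspec, of a "\<one>\<^bsub>GX\<^esub>"] by (simp add: class_coc_one)
  qed
qed (use GC.ideal_seq_diff in blast)

lemma card_Ret_X:
  "card (fst ((Ret ^^ m) (X, r))) = 1 \<longleftrightarrow> (\<forall>x\<in>X. \<forall>y\<in>X. iter_ret_rel X lt m x y)"
  by (rule left_congruent.card_Ret_eq_1_iff[OF left_congruent_X])

lemma card_Ret_GX:
  "card (fst ((Ret ^^ m) (carrier GX, rG X r))) = 1 \<longleftrightarrow> class_coc ` carrier GX \<subseteq> GC.ideal_seq m"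
  unfolding left_congruent.card_Ret_eq_1_iff[OF left_congruent_GX] full_iff[symmetric]
  by (simp add: iter_ret_rel_GX)

lemma card_Ret_Gperm:
  "card (fst ((Ret ^^ m) (Gperm X r, r_perm X r))) = 1
    \<longleftrightarrow> class_coc ` carrier GX \<subseteq> GC.ideal_seq (Suc m)"
  unfolding left_congruent.card_Ret_eq_1_iff[OF left_congruent_Gperm] full_iff[symmetric]
  by (simp add: Gperm_def iter_ret_rel_Gperm[unfolded Gperm_def] del: GC.ideal_seq.simps)

lemma card_Ret_GX_imp_X:
  "card (fst ((Ret ^^ m) (carrier GX, rG X r))) = 1 \<Longrightarrow> card (fst ((Ret ^^ m) (X, r))) = 1"
  unfolding card_Ret_X card_Ret_GX full_iff[symmetric] by (simp add: GC.iter_ret_rel_generators)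

lemma card_Ret_X_imp_GX:
  "card (fst ((Ret ^^ m) (X, r))) = 1 \<Longrightarrow> card (fst ((Ret ^^ Suc m) (carrier GX, rG X r))) = 1"
  unfolding card_Ret_X card_Ret_GX by (rule GC.ideal_seq_Suc_full) blast

lemma card_Ret_X_imp_GX_of_cond_star:
  "cond_star X r \<Longrightarrow> card (fst ((Ret ^^ Suc m) (X, r))) = 1 \<Longrightarrow>
    card (fst ((Ret ^^ Suc m) (carrier GX, rG X r))) = 1"
  unfolding card_Ret_X card_Ret_GX cond_star_def by (rule GC.ideal_seq_full_of_fixing) blast+

end

text \<open>\<open>TG (Suc m)\<close> will say that the m-th retraction of the permutation group is
  trivial. Because level 0 fails, the least level of the group is a successor and the truncated
  subtraction loses nothing.\<close>

lemma mpl_comparison: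
  fixes TG TX :: "nat \<Rightarrow> bool"
  assumes GX: "\<And>m. TG m \<Longrightarrow> TX m" and XG: "\<And>m. TX m \<Longrightarrow> TG (Suc m)" and G0: "\<not> TG 0"
    and G: "TG k"
  shows "1 \<le> Least TG" "(LEAST m. TG (Suc m)) = Least TG - 1"
    "Least TG - 1 \<le> Least TX" "Least TX \<le> Least TG"
proof -
  have "Least TG = Suc (LEAST m. TG (Suc m))"
    using Least_Suc[of TG, OF G G0] .
  then show "1 \<le> Least TG" "(LEAST m. TG (Suc m)) = Least TG - 1"
    by simp_all
  have "TG (Suc (Least TX))"
    using XG[OF LeastI[of TX k]] GX G by blast
  then show "Least TG - 1 \<le> Least TX"
    using Least_le[of TG "Suc (Least TX)"] by simp
  show "Least TX \<le> Least TG"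
    using GX LeastI[of TG k] G by (blast intro: Least_le)
qed

theorem mainTheorem9:
  fixes X :: "'a set" and r :: "'a \<times> 'a \<Rightarrow> 'a \<times> 'a"
  assumes "symset X r"
    and "\<exists>x\<in>X. \<exists>y\<in>X. x \<noteq> y"
  shows "(is_mp (carrier (Gpres X r)) (rG X r) \<longleftrightarrow> is_mp X r)
    \<and> (is_mp (carrier (Gpres X r)) (rG X r) \<longrightarrow>
         (let m = mpl (carrier (Gpres X r)) (rG X r) in
            1 \<le> m
          \<and> is_mp (Gperm X r) (r_perm X r)
          \<and> mpl (Gperm X r) (r_perm X r) = m - 1
          \<and> m - 1 \<le> mpl X r
          \<and> mpl X r \<le> m))
    \<and> ((cond_star X r \<or> square_free X r) \<longrightarrow>
         (\<forall>m. (is_mp X r \<and> mpl X r = m) \<longleftrightarrow>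
              (is_mp (carrier (Gpres X r)) (rG X r) \<and> mpl (carrier (Gpres X r)) (rG X r) = m)))"
proof -
  interpret symmetric_set X r
    by unfold_locales fact
  define TX where "TX m \<longleftrightarrow> card (fst ((Ret ^^ m) (X, r))) = 1" for m
  define TG where "TG m \<longleftrightarrow> card (fst ((Ret ^^ m) (carrier GX, rG X r))) = 1" for m
  have TP: "TG (Suc m) \<longleftrightarrow> card (fst ((Ret ^^ m) (Gperm X r, r_perm X r))) = 1" for m
    unfolding TG_def card_Ret_GX card_Ret_Gperm ..
  have TGX: "TX m" if "TG m" for m
    using that card_Ret_GX_imp_X by (simp only: TX_def TG_def)
  have TXG: "TG (Suc m)" if "TX m" for m
    using that card_Ret_X_imp_GX by (simp only: TX_def TG_def)
  \<comment> \<open>The two distinct elements of X enter here; the contrapositive of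
    \<open>TGX\<close> passes the exclusion of level 0 on to the group.\<close>
  have X0: "\<not> TX 0"
    using assms(2) unfolding TX_def card_Ret_X by simp
  then have G0: "\<not> TG 0"
    using TGX by blast
  have mp: "is_mp X r \<longleftrightarrow> (\<exists>m. TX m)" "is_mp (carrier GX) (rG X r) \<longleftrightarrow> (\<exists>m. TG m)"
    "is_mp (Gperm X r) (r_perm X r) \<longleftrightarrow> (\<exists>m. TG (Suc m))"
    unfolding is_mp_def TP by (simp_all only: TX_def TG_def)
  have mpl: "mpl X r = Least TX" "mpl (carrier GX) (rG X r) = Least TG"
    "mpl (Gperm X r) (r_perm X r) = (LEAST m. TG (Suc m))"
    unfolding mpl_def TP by (simp_all only: TX_def[abs_def] TG_def[abs_def])
  have 1: "(\<exists>m. TG m) \<longleftrightarrow> (\<exists>m. TX m)"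
    using TGX TXG by blast
  have 2: "1 \<le> Least TG \<and> (\<exists>m. TG (Suc m)) \<and> (LEAST m. TG (Suc m)) = Least TG - 1
      \<and> Least TG - 1 \<le> Least TX \<and> Least TX \<le> Least TG" if "TG k" for k
    using mpl_comparison[of TG TX, OF TGX TXG G0 that] TXG TGX that by blast
  have 3: "TG = TX" if "cond_star X r \<or> square_free X r"
  proof -
    \<comment> \<open>A square-free solution allows a = x.\<close>
    have star: "cond_star X r"
      using that by (force simp: cond_star_def square_free_def)
    \<comment> \<open>Level 0 is excluded by \<open>X0\<close>; at a successor the argument with
      fixing elements applies.\<close>
    have "TG m" if "TX m" for m
      using that X0 card_Ret_X_imp_GX_of_cond_star[OF star]
      by (cases m) (simp_all only: TX_def TG_def)
    then show ?thesis
      using TGX by blast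
  qed
  show ?thesis
    unfolding mp mpl Let_def using 1 2 3 by auto
qed

end
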